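(* Let $n\ge 2$. The alternating group $B_n^+$ of type B is isomorphic to the group generated by $a_1,\dots,a_{n-1}$ with the defining relations $$\left\{\begin{array}{ll} a_i^4=1 & \text{for } i=1,\dots,n-1,\\ (a_1a_i)^3=1 & \text{for } i=2,\dots,n-1,\\ (a_1^2a_i)^2=1 & \text{for } i=2,\dots,n-1,\\ (a_1a_ia_1a_j)^2=1 & \text{for } i,j=2,\dots,n-1 \text{ such that } i<j. \end{array}\right.$$ Identifying $B_n^+$ with the subgroup $\{(g,\pi):\epsilon_{C_2^n}(g)\,\epsilon_0(\pi)=1\}$ of $C_2\wr \mathfrak{S}_n$ (see the context), the isomorphism is given by $a_i\mapsto\bigl(\gamma^{(1)},(1,i+1)\bigr)$, $i=1,\dots,n-1$.
   Context: The Coxeter group $B_n$ is generated by $s_0,\dots,s_{n-1}$ with defining relations $s_i^2=1$ for $i=0,\dots,n-1$; $s_0s_1s_0s_1=s_1s_0s_1s_0$; $s_is_{i+1}s_i=s_{i+1}s_is_{i+1}$ for $i=1,\dots,n-2$; $s_is_j=s_js_i$ for $|i-j|>1$. The alternating group $B_n^+$ is the kernel of the homomorphism $B_n\to\{-1,1\}$ with $s_i\mapsto-1$ for all $i$. Let $C_2$ be the cyclic group of order $2$ with generator $\gamma$, and let $\gamma^{(i)}\in C_2^n$ be the element with $\gamma$ in position $i$ and the unit element elsewhere. $\mathfrak{S}_n$ is the symmetric group on $\{1,\dots,n\}$; products of permutations are composed right to left ($\pi\sigma$ means $\sigma$ first, then $\pi$). The wreath product $C_2\wr\mathfrak{S}_n$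 consists of pairs $(g,\pi)$, $g\in C_2^n$, $\pi\in\mathfrak{S}_n$, with $(g,\pi)(g',\pi')=(g\cdot\pi(g'),\pi\pi')$ where $\pi(\gamma^{(i)})=\gamma^{(\pi(i))}$. The group $B_n$ is identified with $C_2\wr\mathfrak{S}_n$ by $s_0\mapsto(\gamma^{(1)},1)$ and $s_i\mapsto(1,(i,i+1))$ for $i=1,\dots,n-1$. Let $\epsilon_0$ be the sign character of $\mathfrak{S}_n$ and $\epsilon_{C_2^n}:C_2^n\to\{-1,1\}$ the homomorphism with $\epsilon_{C_2^n}(\gamma^{(i)})=-1$ for all $i$; then $B_n^+$ corresponds to the pairs $(g,\pi)$ with $\epsilon_{C_2^n}(g)\epsilon_0(\pi)=1$. *)

theory Defs
  imports "HOL-Algebra.Sym_Groups" "HOL-Algebra.Product_Groups" "HOL-Algebra.Elementary_Groups"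
begin

section \<open>Groups given by generators and defining relations\<close>

text \<open>A letter \<open>(x, True)\<close> stands for the generator \<open>x\<close>, and \<open>(x, False)\<close> for its formal inverse.\<close>

type_synonym 'a gword = "('a \<times> bool) list"

definition gwords :: "'a set \<Rightarrow> 'a gword set"
  where "gwords S = lists (S \<times> UNIV)"

text \<open>The congruence on words generated by free cancellation and by the relations
  \<open>l = r\<close> with \<open>(l, r) \<in> R\<close>. Its quotient is the free group on \<open>S\<close> modulo the normal closure of
  the elements \<open>l r\<^sup>-\<^sup>1\<close>.\<close>

inductive pres_eq :: "'a set \<Rightarrow> ('a gword \<times> 'a gword) set \<Rightarrow> 'a gword \<Rightarrow> 'a gword \<Rightarrow> bool"
  for S R where
  refl: "w \<in> gwords S \<Longrightarrow> pres_eq S R w w"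
| sym: "pres_eq S R u v \<Longrightarrow> pres_eq S R v u"
| trans: "pres_eq S R u v \<Longrightarrow> pres_eq S R v w \<Longrightarrow> pres_eq S R u w"
| cancel: "\<lbrakk>u \<in> gwords S; v \<in> gwords S; x \<in> S\<rbrakk>
    \<Longrightarrow> pres_eq S R (u @ [(x, b), (x, \<not> b)] @ v) (u @ v)"
| relation: "\<lbrakk>u \<in> gwords S; v \<in> gwords S; (l, r) \<in> R; l \<in> gwords S; r \<in> gwords S\<rbrakk>
    \<Longrightarrow> pres_eq S R (u @ l @ v) (u @ r @ v)"

definition pres_rel :: "'a set \<Rightarrow> ('a gword \<times> 'a gword) set \<Rightarrow> ('a gword \<times> 'a gword) set"
  where "pres_rel S R = {(u, v). pres_eq S R u v}"

definition presented_group :: "'a set \<Rightarrow> ('a gword \<times> 'a gword) set \<Rightarrow> 'a gword set monoid"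
  where "presented_group S R =
    \<lparr> carrier = gwords S // pres_rel S R,
      mult = (\<lambda>X Y. \<Union>u\<in>X. \<Union>v\<in>Y. pres_rel S R `` {u @ v}),
      one = pres_rel S R `` {[]} \<rparr>"

definition pres_gen :: "'a set \<Rightarrow> ('a gword \<times> 'a gword) set \<Rightarrow> 'a \<Rightarrow> 'a gword set"
  where "pres_gen S R x = pres_rel S R `` {[(x, True)]}"

text \<open>The value of a word in a group under an assignment \<open>f\<close> of the generators, and the map out of
  a presented group that \<open>f\<close> induces. The latter is a homomorphism extending \<open>f\<close> whenever \<open>f\<close>
  respects the relations; see \<open>pres_lift_hom\<close> and \<open>pres_lift_gen\<close>.\<close>

fun word_value :: "('b, 'c) monoid_scheme \<Rightarrow> ('a \<Rightarrow> 'b) \<Rightarrow> 'a gword \<Rightarrow> 'b" where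
  "word_value H f [] = \<one>\<^bsub>H\<^esub>"
| "word_value H f ((x, b) # w) = (if b then f x else inv\<^bsub>H\<^esub> (f x)) \<otimes>\<^bsub>H\<^esub> word_value H f w"

definition pres_lift :: "('b, 'c) monoid_scheme \<Rightarrow> ('a \<Rightarrow> 'b) \<Rightarrow> 'a gword set \<Rightarrow> 'b"
  where "pres_lift H f X = word_value H f (SOME w. w \<in> X)"

lemma gwords_simps [simp]:
  "[] \<in> gwords S"
  "p # w \<in> gwords S \<longleftrightarrow> fst p \<in> S \<and> w \<in> gwords S"
  "u @ v \<in> gwords S \<longleftrightarrow> u \<in> gwords S \<and> v \<in> gwords S"
  by (cases p; auto simp: gwords_def)+

lemma pres_eq_words: "pres_eq S R u v \<Longrightarrow> u \<in> gwords S \<and> v \<in> gwords S"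
  by (induction rule: pres_eq.induct) auto

lemma equiv_pres_rel: "equiv (gwords S) (pres_rel S R)"
proof (rule equivI)
  show "pres_rel S R \<subseteq> gwords S \<times> gwords S"
    by (auto simp: pres_rel_def dest: pres_eq_words)
  show "refl_on (gwords S) (pres_rel S R)"
    by (auto simp: refl_on_def pres_rel_def intro: pres_eq.refl)
  show "Relation.sym (pres_rel S R)"
    by (auto simp: sym_def pres_rel_def intro: pres_eq.sym)
  show "Relation.trans (pres_rel S R)"
    by (auto simp: trans_def pres_rel_def intro: pres_eq.trans)
qed

lemma pres_eq_append_right:
  assumes "pres_eq S R u v" "w \<in> gwords S" shows "pres_eq S R (u @ w) (v @ w)"
  using assms
proof (induction rule: pres_eq.induct)
  case (cancel u v x b) then show ?case using pres_eq.cancel[of u S "v @ w" x R b] by simp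
next
  case (relation u v l r) then show ?case using pres_eq.relation[of u S "v @ w" l r R] by simp
qed (auto intro: pres_eq.refl pres_eq.sym pres_eq.trans)

lemma pres_eq_append_left:
  assumes "pres_eq S R u v" "w \<in> gwords S" shows "pres_eq S R (w @ u) (w @ v)"
  using assms
proof (induction rule: pres_eq.induct)
  case (cancel u v x b) then show ?case using pres_eq.cancel[of "w @ u" S v x R b] by simp
next
  case (relation u v l r) then show ?case using pres_eq.relation[of "w @ u" S v l r R] by simp
qed (auto intro: pres_eq.refl pres_eq.sym pres_eq.trans)

lemma pres_eq_append:
  "pres_eq S R u u' \<Longrightarrow> pres_eq S R v v' \<Longrightarrow> pres_eq S R (u @ v) (u' @ v')"
  by (meson pres_eq.trans pres_eq_append_left pres_eq_append_right pres_eq_words)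

lemma pres_class_eq_iff:
  "u \<in> gwords S \<Longrightarrow> v \<in> gwords S \<Longrightarrow>
    pres_rel S R `` {u} = pres_rel S R `` {v} \<longleftrightarrow> pres_eq S R u v"
  using eq_equiv_class_iff[OF equiv_pres_rel, of u S v R] by (simp add: pres_rel_def)

lemma presented_group_carrier:
  "carrier (presented_group S R) = (\<lambda>w. pres_rel S R `` {w}) ` gwords S"
  by (auto simp: presented_group_def quotient_def)

lemma pres_class_self: "w \<in> gwords S \<Longrightarrow> w \<in> pres_rel S R `` {w}"
  by (simp add: pres_rel_def pres_eq.refl)

lemma presented_group_mult:
  assumes "u \<in> gwords S" "v \<in> gwords S"
  shows "pres_rel S R `` {u} \<otimes>\<^bsub>presented_group S R\<^esub> pres_rel S R `` {v} = pres_rel S R `` {u @ v}"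
proof -
  let ?c = "\<lambda>w. pres_rel S R `` {w}"
  have c: "?c (u' @ v') = ?c (u @ v)" if "u' \<in> ?c u" "v' \<in> ?c v" for u' v'
  proof -
    have "pres_eq S R (u @ v) (u' @ v')"
      using that by (simp add: pres_rel_def pres_eq_append)
    moreover from this have "u @ v \<in> gwords S" "u' @ v' \<in> gwords S"
      using pres_eq_words by blast+
    ultimately show ?thesis using pres_class_eq_iff by metis
  qed
  have "(\<Union>u'\<in>?c u. \<Union>v'\<in>?c v. ?c (u' @ v')) = (\<Union>u'\<in>?c u. \<Union>v'\<in>?c v. ?c (u @ v))"
    by (intro SUP_cong HOL.refl c)
  also have "\<dots> = ?c (u @ v)"
  proof -
    have "?c u \<noteq> {}" "?c v \<noteq> {}"
      using assms pres_class_self by (metis empty_iff)+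
    then show ?thesis by (simp only: UN_constant if_False)
  qed
  finally show ?thesis by (simp only: presented_group_def monoid.simps)
qed

lemma group_presented_group: "group (presented_group S R)"
proof (rule groupI)
  fix X assume "X \<in> carrier (presented_group S R)"
  then obtain w where w: "w \<in> gwords S" "X = pres_rel S R `` {w}"
    by (auto simp: presented_group_carrier)
  have "\<exists>v \<in> gwords S. pres_eq S R (v @ w) []"
    using w(1)
  proof (induction w)
    case Nil then show ?case using pres_eq.refl[of "[]"] by (intro bexI[of _ "[]"]) auto
  next
    case (Cons p w)
    obtain x b where p: "p = (x, b)" by (cases p)
    obtain v where v: "v \<in> gwords S" "pres_eq S R (v @ w) []" using Cons by auto
    have "pres_eq S R (v @ [(x, \<not> b), (x, \<not> \<not> b)] @ w) (v @ w)"
      using Cons.prems v p by (intro pres_eq.cancel) auto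
    then show ?case using v Cons.prems p
      by (intro bexI[of _ "v @ [(x, \<not> b)]"]) (auto intro: pres_eq.trans)
  qed
  then obtain v where v: "v \<in> gwords S" "pres_eq S R (v @ w) []" by auto
  then have "pres_rel S R `` {v} \<otimes>\<^bsub>presented_group S R\<^esub> X = \<one>\<^bsub>presented_group S R\<^esub>"
    using w by (simp add: presented_group_mult pres_class_eq_iff) 
       (simp add: presented_group_def pres_class_eq_iff)
  then show "\<exists>Y \<in> carrier (presented_group S R). Y \<otimes>\<^bsub>presented_group S R\<^esub> X = \<one>\<^bsub>presented_group S R\<^esub>"
    using v by (auto simp: presented_group_carrier)
next
  fix X assume "X \<in> carrier (presented_group S R)"
  then show "\<one>\<^bsub>presented_group S R\<^esub> \<otimes>\<^bsub>presented_group S R\<^esub> X = X"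
    using presented_group_mult[of "[]" S _ R]
    by (auto simp: presented_group_carrier) (auto simp: presented_group_def)
next
  show "\<one>\<^bsub>presented_group S R\<^esub> \<in> carrier (presented_group S R)"
    by (auto simp: presented_group_carrier) (auto simp: presented_group_def)
qed (auto simp: presented_group_carrier presented_group_mult)

context group
begin

lemma word_value_closed:
  assumes "f \<in> S \<rightarrow> carrier G" "w \<in> gwords S" shows "word_value G f w \<in> carrier G"
  using assms(2) by (induction w) (use assms(1) in \<open>auto simp: Pi_iff\<close>)

lemma word_value_append:
  assumes "f \<in> S \<rightarrow> carrier G" "u \<in> gwords S" "v \<in> gwords S"
  shows "word_value G f (u @ v) = word_value G f u \<otimes> word_value G f v"
  using assms(2)
proof (induction u)
  case (Cons p u)
  then show ?case using assms(1) word_value_closed[OF assms(1)] assms(3)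
    by (cases p) (auto simp: Pi_iff m_assoc)
qed (simp add: word_value_closed[OF assms(1,3)])

lemma word_value_cong:
  assumes f: "f \<in> S \<rightarrow> carrier G"
    and R: "\<And>l r. (l, r) \<in> R \<Longrightarrow> word_value G f l = word_value G f r"
    and "pres_eq S R u v"
  shows "word_value G f u = word_value G f v"
  using assms(3)
proof (induction rule: pres_eq.induct)
  case (cancel u v x b)
  then have "f x \<in> carrier G" "word_value G f v \<in> carrier G"
    using f word_value_closed[OF f] by auto
  then have "word_value G f ([(x, b), (x, \<not> b)] @ v) = word_value G f v"
    by (auto simp flip: m_assoc)
  then show ?case using cancel
    by (simp add: word_value_append[OF f] del: word_value.simps append_Cons append_Nil)
next
  case (relation u v l r)
  then show ?case by (simp add: word_value_append[OF f] R)
qed auto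

lemma pres_lift_class:
  assumes f: "f \<in> S \<rightarrow> carrier G"
    and R: "\<And>l r. (l, r) \<in> R \<Longrightarrow> word_value G f l = word_value G f r"
    and w: "w \<in> gwords S"
  shows "pres_lift G f (pres_rel S R `` {w}) = word_value G f w"
proof -
  have "w \<in> pres_rel S R `` {w}" using w by (auto simp: pres_rel_def intro: pres_eq.refl)
  then have "(SOME v. v \<in> pres_rel S R `` {w}) \<in> pres_rel S R `` {w}" by (rule someI)
  then have "pres_eq S R w (SOME v. v \<in> pres_rel S R `` {w})" by (simp add: pres_rel_def)
  then show ?thesis unfolding pres_lift_def using word_value_cong[OF f R] by metis
qed

lemma pres_lift_hom:
  assumes f: "f \<in> S \<rightarrow> carrier G"
    and R: "\<And>l r. (l, r) \<in> R \<Longrightarrow> word_value G f l = word_value G f r"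
  shows "pres_lift G f \<in> hom (presented_group S R) G"
  by (auto simp: hom_def presented_group_carrier pres_lift_class[OF f R] presented_group_mult
      word_value_append[OF f] word_value_closed[OF f])

lemma pres_lift_gen:
  assumes f: "f \<in> S \<rightarrow> carrier G"
    and R: "\<And>l r. (l, r) \<in> R \<Longrightarrow> word_value G f l = word_value G f r"
    and x: "x \<in> S"
  shows "pres_lift G f (pres_gen S R x) = f x"
  unfolding pres_gen_def
  by (subst pres_lift_class[OF f R]) (use f x in \<open>auto simp: Pi_iff\<close>)

end

abbreviation letter :: "'a \<Rightarrow> 'a gword"
  where "letter x \<equiv> [(x, True)]"

definition word_power :: "'a gword \<Rightarrow> nat \<Rightarrow> 'a gword"
  where "word_power w k = concat (replicate k w)"


section \<open>The Coxeter group of type B and its alternating subgroup\<close>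

definition coxeter_B_rels :: "nat \<Rightarrow> (nat gword \<times> nat gword) set"
  where "coxeter_B_rels n =
      {(word_power (letter i) 2, []) | i. i < n}
    \<union> {(letter 0 @ letter 1 @ letter 0 @ letter 1, letter 1 @ letter 0 @ letter 1 @ letter 0)}
    \<union> {(letter i @ letter (i + 1) @ letter i, letter (i + 1) @ letter i @ letter (i + 1)) | i.
         1 \<le> i \<and> i + 1 < n}
    \<union> {(letter i @ letter j, letter j @ letter i) | i j.
         i < n \<and> j < n \<and> \<bar>int i - int j\<bar> > 1}"

definition coxeter_B :: "nat \<Rightarrow> nat gword set monoid"
  where "coxeter_B n = presented_group {..<n} (coxeter_B_rels n)"

definition coxeter_B_gen :: "nat \<Rightarrow> nat \<Rightarrow> nat gword set"
  where "coxeter_B_gen n i = pres_gen {..<n} (coxeter_B_rels n) i"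

definition coxeter_B_sign :: "nat \<Rightarrow> nat gword set \<Rightarrow> int"
  where "coxeter_B_sign n = pres_lift sign_img (\<lambda>i. -1)"

definition alternating_B :: "nat \<Rightarrow> nat gword set monoid"
  where "alternating_B n =
    (coxeter_B n)\<lparr> carrier := kernel (coxeter_B n) sign_img (coxeter_B_sign n) \<rparr>"


section \<open>The wreath product of the cyclic group of order 2 with a symmetric group\<close>

abbreviation C2 :: "int monoid"
  where "C2 \<equiv> integer_mod_group 2"

definition C2_gen :: int
  where "C2_gen = 1"

definition C2_pow :: "nat \<Rightarrow> (nat \<Rightarrow> int) monoid"
  where "C2_pow n = product_group {1..n} (\<lambda>_. C2)"

definition gamma :: "nat \<Rightarrow> nat \<Rightarrow> nat \<Rightarrow> int"
  where "gamma n i = (\<lambda>j\<in>{1..n}. if j = i then C2_gen else \<one>\<^bsub>C2\<^esub>)"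

text \<open>The action by automorphisms with \<open>\<pi>(\<gamma>\<^sup>(\<^sup>i\<^sup>)) = \<gamma>\<^sup>(\<^sup>\<pi>\<^sup>(\<^sup>i\<^sup>)\<^sup>)\<close>; see \<open>perm_act_gamma\<close>.\<close>

definition perm_act :: "nat \<Rightarrow> (nat \<Rightarrow> nat) \<Rightarrow> (nat \<Rightarrow> int) \<Rightarrow> nat \<Rightarrow> int"
  where "perm_act n \<pi> g = (\<lambda>j\<in>{1..n}. g (Hilbert_Choice.inv \<pi> j))"

definition wreath_C2 :: "nat \<Rightarrow> ((nat \<Rightarrow> int) \<times> (nat \<Rightarrow> nat)) monoid"
  where "wreath_C2 n =
    \<lparr> carrier = carrier (C2_pow n) \<times> carrier (sym_group n),
      mult = (\<lambda>(g, \<pi>) (g', \<pi>'). (g \<otimes>\<^bsub>C2_pow n\<^esub> perm_act n \<pi> g', \<pi> \<otimes>\<^bsub>sym_group n\<^esub> \<pi>')),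
      one = (\<one>\<^bsub>C2_pow n\<^esub>, \<one>\<^bsub>sym_group n\<^esub>) \<rparr>"

definition C2_pow_sign :: "nat \<Rightarrow> (nat \<Rightarrow> int) \<Rightarrow> int"
  where "C2_pow_sign n g = (\<Prod>i\<in>{1..n}. if g i = C2_gen then -1 else 1)"

definition alternating_wreath :: "nat \<Rightarrow> ((nat \<Rightarrow> int) \<times> (nat \<Rightarrow> nat)) set"
  where "alternating_wreath n =
    {(g, \<pi>) \<in> carrier (wreath_C2 n). C2_pow_sign n g * sign \<pi> = 1}"

definition wreath_gen :: "nat \<Rightarrow> nat \<Rightarrow> (nat \<Rightarrow> int) \<times> (nat \<Rightarrow> nat)"
  where "wreath_gen n i =
    (if i = 0 then (gamma n 1, \<one>\<^bsub>sym_group n\<^esub>)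
     else (\<one>\<^bsub>C2_pow n\<^esub>, Transposition.transpose i (i + 1)))"

definition B_identification :: "nat \<Rightarrow> nat gword set \<Rightarrow> (nat \<Rightarrow> int) \<times> (nat \<Rightarrow> nat)"
  where "B_identification n = pres_lift (wreath_C2 n) (wreath_gen n)"


section \<open>The group on the generators \<open>a\<^sub>1, \<dots>, a\<^sub>n\<^sub>-\<^sub>1\<close>\<close>

definition alt_B_rels :: "nat \<Rightarrow> (nat gword \<times> nat gword) set"
  where "alt_B_rels n =
      {(word_power (letter i) 4, []) | i. 1 \<le> i \<and> i \<le> n - 1}
    \<union> {(word_power (letter 1 @ letter i) 3, []) | i. 2 \<le> i \<and> i \<le> n - 1}
    \<union> {(word_power (word_power (letter 1) 2 @ letter i) 2, []) | i. 2 \<le> i \<and> i \<le> n - 1}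
    \<union> {(word_power (letter 1 @ letter i @ letter 1 @ letter j) 2, []) | i j.
         2 \<le> i \<and> i < j \<and> j \<le> n - 1}"

definition alt_B_presented :: "nat \<Rightarrow> nat gword set monoid"
  where "alt_B_presented n = presented_group {1..n - 1} (alt_B_rels n)"

definition alt_B_gen :: "nat \<Rightarrow> nat \<Rightarrow> nat gword set"
  where "alt_B_gen n i = pres_gen {1..n - 1} (alt_B_rels n) i"


section \<open>Well-definedness of the maps above\<close>

lemma coxeter_B_sign_hom: "coxeter_B_sign n \<in> hom (coxeter_B n) sign_img"
  and coxeter_B_sign_gen: "i < n \<Longrightarrow> coxeter_B_sign n (coxeter_B_gen n i) = -1"
proof -
  interpret group sign_img by (rule sign_img_is_group)
  have f: "(\<lambda>i. -1) \<in> {..<n} \<rightarrow> carrier sign_img" by (simp add: sign_img_def)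
  have R: "word_value sign_img (\<lambda>i. -1) l = word_value sign_img (\<lambda>i. -1) r"
    if "(l, r) \<in> coxeter_B_rels n" for l r
    using that by (auto simp: coxeter_B_rels_def word_power_def sign_img_def numeral_2_eq_2)
  show "coxeter_B_sign n \<in> hom (coxeter_B n) sign_img"
    unfolding coxeter_B_sign_def coxeter_B_def by (rule pres_lift_hom[OF f R])
  show "i < n \<Longrightarrow> coxeter_B_sign n (coxeter_B_gen n i) = -1"
    unfolding coxeter_B_sign_def coxeter_B_gen_def by (rule pres_lift_gen[OF f R]) auto
qed

lemma perm_act_gamma:
  assumes "\<pi> permutes {1..n}" shows "perm_act n \<pi> (gamma n i) = gamma n (\<pi> i)"
proof
  fix j
  show "perm_act n \<pi> (gamma n i) j = gamma n (\<pi> i) j"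
  proof (cases "j \<in> {1..n}")
    case True
    then have "Hilbert_Choice.inv \<pi> j \<in> {1..n}"
      by (simp only: permutes_in_image[OF permutes_inv[OF assms]])
    moreover have "Hilbert_Choice.inv \<pi> j = i \<longleftrightarrow> j = \<pi> i"
      using permutes_inverses[OF assms] by auto
    ultimately show ?thesis using True by (simp add: perm_act_def gamma_def del: atLeastAtMost_iff)
  next
    case False
    then show ?thesis by (simp only: perm_act_def gamma_def restrict_apply if_False)
  qed
qed

lemma C2_pow_mult: "g \<otimes>\<^bsub>C2_pow n\<^esub> h = (\<lambda>i\<in>{1..n}. (g i + h i) mod 2)"
  by (simp add: C2_pow_def)

lemma group_C2_pow: "group (C2_pow n)"
  by (simp add: C2_pow_def)

lemma perm_act_closed:
  assumes "\<pi> permutes {1..n}" "g \<in> carrier (C2_pow n)" shows "perm_act n \<pi> g \<in> carrier (C2_pow n)"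
  using assms(2) permutes_in_image[OF permutes_inv[OF assms(1)]]
  by (auto simp: C2_pow_def perm_act_def PiE_iff simp del: atLeastAtMost_iff)

lemma perm_act_mult:
  assumes "\<pi> permutes {1..n}"
  shows "perm_act n \<pi> (g \<otimes>\<^bsub>C2_pow n\<^esub> h) = perm_act n \<pi> g \<otimes>\<^bsub>C2_pow n\<^esub> perm_act n \<pi> h"
  using permutes_in_image[OF permutes_inv[OF assms]]
  by (auto simp: C2_pow_mult perm_act_def fun_eq_iff simp del: atLeastAtMost_iff)

lemma perm_act_comp:
  assumes "\<pi> permutes {1..n}" "\<sigma> permutes {1..n}"
  shows "perm_act n (\<pi> \<circ> \<sigma>) g = perm_act n \<pi> (perm_act n \<sigma> g)"
  using permutes_in_image[OF permutes_inv[OF assms(1)]]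
  by (auto simp: perm_act_def fun_eq_iff o_inv_distrib permutes_bij[OF assms(1)]
      permutes_bij[OF assms(2)] simp del: atLeastAtMost_iff)

lemma perm_act_id:
  assumes "g \<in> carrier (C2_pow n)" shows "perm_act n id g = g"
  using assms by (auto simp: C2_pow_def perm_act_def PiE_iff extensional_def fun_eq_iff)

lemma group_wreath_C2: "group (wreath_C2 n)"
proof -
  interpret C: group "C2_pow n" by (rule group_C2_pow)
  interpret P: group "sym_group n" by (rule sym_group_is_group)
  note simps = wreath_C2_def sym_group_carrier sym_group_mult sym_group_one
  show ?thesis
  proof (rule groupI)
    fix x y assume "x \<in> carrier (wreath_C2 n)" "y \<in> carrier (wreath_C2 n)"
    then show "x \<otimes>\<^bsub>wreath_C2 n\<^esub> y \<in> carrier (wreath_C2 n)"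
      by (auto simp: simps perm_act_closed permutes_compose)
  next
    show "\<one>\<^bsub>wreath_C2 n\<^esub> \<in> carrier (wreath_C2 n)" by (simp add: simps permutes_id)
  next
    fix x y z
    assume "x \<in> carrier (wreath_C2 n)" "y \<in> carrier (wreath_C2 n)" "z \<in> carrier (wreath_C2 n)"
    then show "x \<otimes>\<^bsub>wreath_C2 n\<^esub> y \<otimes>\<^bsub>wreath_C2 n\<^esub> z = x \<otimes>\<^bsub>wreath_C2 n\<^esub> (y \<otimes>\<^bsub>wreath_C2 n\<^esub> z)"
      by (auto simp: simps perm_act_mult perm_act_comp perm_act_closed C.m_assoc o_assoc)
  next
    fix x assume "x \<in> carrier (wreath_C2 n)"
    then show "\<one>\<^bsub>wreath_C2 n\<^esub> \<otimes>\<^bsub>wreath_C2 n\<^esub> x = x" by (auto simp: simps perm_act_id)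
  next
    fix x assume "x \<in> carrier (wreath_C2 n)"
    then obtain g \<pi> where x: "x = (g, \<pi>)" "g \<in> carrier (C2_pow n)" "\<pi> permutes {1..n}"
      by (auto simp: simps)
    let ?\<rho> = "Hilbert_Choice.inv \<pi>"
    have \<rho>: "?\<rho> permutes {1..n}" using x by (simp add: permutes_inv)
    then have "perm_act n ?\<rho> g \<in> carrier (C2_pow n)" using x by (simp add: perm_act_closed)
    then show "\<exists>y \<in> carrier (wreath_C2 n). y \<otimes>\<^bsub>wreath_C2 n\<^esub> x = \<one>\<^bsub>wreath_C2 n\<^esub>"
      using x \<rho> by (intro bexI[of _ "(inv\<^bsub>C2_pow n\<^esub> perm_act n ?\<rho> g, ?\<rho>)"])
        (auto simp: simps permutes_inv_o)
  qed
qed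

lemma gamma_closed: "gamma n i \<in> carrier (C2_pow n)"
  by (auto simp: gamma_def C2_gen_def C2_pow_def carrier_integer_mod_group)

lemma C2_pow_sign_hom: "C2_pow_sign n \<in> hom (C2_pow n) sign_img"
proof (rule homI)
  fix g assume "g \<in> carrier (C2_pow n)"
  have "C2_pow_sign n g = 1 \<or> C2_pow_sign n g = -1"
    unfolding C2_pow_sign_def using finite_atLeastAtMost[of 1 n] by (induction rule: finite_induct) auto
  then show "C2_pow_sign n g \<in> carrier sign_img"
    by (auto simp: sign_img_def)
next
  fix g h assume gh: "g \<in> carrier (C2_pow n)" "h \<in> carrier (C2_pow n)"
  have "(if (g i + h i) mod 2 = 1 then -1 else 1) =
      (if g i = 1 then -1 else 1) * (if h i = 1 then -1 else (1 :: int))" if "i \<in> {1..n}" for i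
  proof -
    have "g i \<in> {0..<2}" "h i \<in> {0..<2}"
      using gh that by (simp_all add: C2_pow_def carrier_integer_mod_group PiE_iff)
    then have "g i = 0 \<or> g i = 1" "h i = 0 \<or> h i = 1" by auto
    then show ?thesis by auto
  qed
  then have "(\<Prod>i\<in>{1..n}. if (g i + h i) mod 2 = 1 then -1 else 1) =
      (\<Prod>i\<in>{1..n}. (if g i = 1 then -1 else 1) * (if h i = 1 then -1 else (1 :: int)))"
    by (rule prod.cong[OF HOL.refl])
  moreover have "C2_pow_sign n (g \<otimes>\<^bsub>C2_pow n\<^esub> h) =
      (\<Prod>i\<in>{1..n}. if (g i + h i) mod 2 = 1 then -1 else 1)"
    unfolding C2_pow_sign_def C2_pow_mult C2_gen_def by (rule prod.cong) auto
  ultimately show "C2_pow_sign n (g \<otimes>\<^bsub>C2_pow n\<^esub> h) = C2_pow_sign n g \<otimes>\<^bsub>sign_img\<^esub> C2_pow_sign n h"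
    by (simp only: C2_pow_sign_def C2_gen_def sign_img_def prod.distrib monoid.simps)
qed

lemma C2_pow_sign_gamma:
  assumes "i \<in> {1..n}" shows "C2_pow_sign n (gamma n i) = -1"
proof -
  have "C2_pow_sign n (gamma n i) = (\<Prod>j\<in>{1..n}. if j = i then -1 else 1)"
    unfolding C2_pow_sign_def by (rule prod.cong) (auto simp: gamma_def C2_gen_def)
  then show ?thesis using assms by simp
qed

lemma wreath_gen_closed:
  assumes "i < n" shows "wreath_gen n i \<in> carrier (wreath_C2 n)"
proof (cases "i = 0")
  case True
  then show ?thesis
    by (simp add: wreath_gen_def wreath_C2_def gamma_closed sym_group_carrier sym_group_one permutes_id)
next
  case False
  then have "Transposition.transpose i (i + 1) permutes {1..n}"
    using assms by (intro permutes_swap_id) auto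
  moreover have "\<one>\<^bsub>C2_pow n\<^esub> \<in> carrier (C2_pow n)"
    using group.is_monoid[OF group_C2_pow] by (rule monoid.one_closed)
  ultimately show ?thesis
    using False by (simp add: wreath_gen_def wreath_C2_def sym_group_carrier)
qed

lemma perm_act_one:
  assumes "\<pi> permutes {1..n}" shows "perm_act n \<pi> \<one>\<^bsub>C2_pow n\<^esub> = \<one>\<^bsub>C2_pow n\<^esub>"
  using permutes_in_image[OF permutes_inv[OF assms]]
  by (auto simp: C2_pow_def perm_act_def fun_eq_iff simp del: atLeastAtMost_iff)

lemma gamma_square: "gamma n i \<otimes>\<^bsub>C2_pow n\<^esub> gamma n i = \<one>\<^bsub>C2_pow n\<^esub>"
  by (auto simp: C2_pow_def gamma_def C2_gen_def fun_eq_iff)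

lemma gamma_commute: "gamma n i \<otimes>\<^bsub>C2_pow n\<^esub> gamma n j = gamma n j \<otimes>\<^bsub>C2_pow n\<^esub> gamma n i"
  by (simp add: C2_pow_mult add.commute)

lemma wreath_gen_relations:
  assumes "n \<ge> 2" "(l, r) \<in> coxeter_B_rels n"
  shows "word_value (wreath_C2 n) (wreath_gen n) l = word_value (wreath_C2 n) (wreath_gen n) r"
proof -
  interpret C: group "C2_pow n" by (rule group_C2_pow)
  let ?t = "\<lambda>i::nat. Transposition.transpose i (i + 1)"
  have t: "?t i permutes {1..n}" if "1 \<le> i" "i < n" for i
    using that by (intro permutes_swap_id) auto
  have id: "id permutes {1..n}" by (rule permutes_id)
  have mult: "(g, \<pi>) \<otimes>\<^bsub>wreath_C2 n\<^esub> (h, \<sigma>) = (g \<otimes>\<^bsub>C2_pow n\<^esub> perm_act n \<pi> h, \<pi> \<circ> \<sigma>)" for g \<pi> h \<sigma>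
    by (simp add: wreath_C2_def sym_group_mult)
  have one: "\<one>\<^bsub>wreath_C2 n\<^esub> = (\<one>\<^bsub>C2_pow n\<^esub>, id)"
    by (simp add: wreath_C2_def sym_group_one)
  have gen0: "wreath_gen n 0 = (gamma n 1, id)"
    by (simp add: wreath_gen_def sym_group_one)
  have gen: "wreath_gen n i = (\<one>\<^bsub>C2_pow n\<^esub>, ?t i)" if "1 \<le> i" for i
    using that by (simp add: wreath_gen_def)
  note simps = mult one gen0 gen perm_act_one t perm_act_id gamma_closed gamma_square
    perm_act_gamma[OF t] perm_act_mult[OF t] id
  consider (sq) i where "i < n" "l = letter i @ letter i" "r = []"
    | (br0) "l = letter 0 @ letter 1 @ letter 0 @ letter 1" "r = letter 1 @ letter 0 @ letter 1 @ letter 0"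
    | (br) i where "1 \<le> i" "i + 1 < n" "l = letter i @ letter (i + 1) @ letter i"
        "r = letter (i + 1) @ letter i @ letter (i + 1)"
    | (comm) i j where "i < n" "j < n" "\<bar>int i - int j\<bar> > 1" "l = letter i @ letter j"
        "r = letter j @ letter i"
    using assms(2) by (auto simp: coxeter_B_rels_def word_power_def numeral_2_eq_2)
  then show ?thesis
  proof cases
    case sq
    then show ?thesis using t[of i] by (cases "i = 0") (auto simp: simps)
  next
    case br0
    have "?t 1 permutes {1..n}" using t[of 1] assms(1) by simp
    then show ?thesis using assms(1) br0
      by (simp add: simps gen[of "Suc 0"] perm_act_mult perm_act_gamma perm_act_one
          gamma_closed C.m_closed perm_act_closed) (rule gamma_commute)
  next
    case br
    have "?t i \<circ> (?t (i + 1) \<circ> ?t i) = ?t (i + 1) \<circ> (?t i \<circ> ?t (i + 1))"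
      by (auto simp: fun_eq_iff Transposition.transpose_def)
    moreover have "word_value (wreath_C2 n) (wreath_gen n) l =
        (\<one>\<^bsub>C2_pow n\<^esub>, ?t i \<circ> (?t (i + 1) \<circ> ?t i))"
      using br t[of i] t[of "i + 1"] by (simp add: simps)
    moreover have "word_value (wreath_C2 n) (wreath_gen n) r =
        (\<one>\<^bsub>C2_pow n\<^esub>, ?t (i + 1) \<circ> (?t i \<circ> ?t (i + 1)))"
      using br t[of i] t[of "i + 1"] by (simp add: simps)
    ultimately show ?thesis by (simp only:)
  next
    case comm
    have tt: "?t i \<circ> ?t j = ?t j \<circ> ?t i"
      using comm(3) by (intro ext) (auto simp: Transposition.transpose_def)
    consider "i = 0" "j \<ge> 2" | "j = 0" "i \<ge> 2" | "i \<ge> 1" "j \<ge> 1" using comm by linarith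
    then show ?thesis
    proof cases
      case 1 then show ?thesis using comm t[of j] by (simp add: simps perm_act_gamma)
    next
      case 2 then show ?thesis using comm t[of i] by (simp add: simps perm_act_gamma)
    next
      case 3
      then have "word_value (wreath_C2 n) (wreath_gen n) l = (\<one>\<^bsub>C2_pow n\<^esub>, ?t i \<circ> ?t j)"
        "word_value (wreath_C2 n) (wreath_gen n) r = (\<one>\<^bsub>C2_pow n\<^esub>, ?t j \<circ> ?t i)"
        using comm t[of i] t[of j] by (simp_all add: simps)
      then show ?thesis by (metis tt)
    qed
  qed
qed

lemma B_identification_hom:
    "n \<ge> 2 \<Longrightarrow> B_identification n \<in> hom (coxeter_B n) (wreath_C2 n)"
  and B_identification_gen:
    "n \<ge> 2 \<Longrightarrow> i < n \<Longrightarrow> B_identification n (coxeter_B_gen n i) = wreath_gen n i"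
proof -
  interpret group "wreath_C2 n" by (rule group_wreath_C2)
  have f: "wreath_gen n \<in> {..<n} \<rightarrow> carrier (wreath_C2 n)" by (simp add: wreath_gen_closed)
  assume n: "n \<ge> 2"
  note R = wreath_gen_relations[OF n]
  show "B_identification n \<in> hom (coxeter_B n) (wreath_C2 n)"
    unfolding B_identification_def coxeter_B_def by (rule pres_lift_hom[OF f R])
  show "B_identification n (coxeter_B_gen n i) = wreath_gen n i" if "i < n"
    unfolding B_identification_def coxeter_B_gen_def by (rule pres_lift_gen[OF f R]) (use that in auto)
qed

end

theory Submission
  imports Defs
begin

text \<open>
  Two presentations have to be recognised: the Coxeter presentation as one of the wreath product
  \<open>C\<^sub>2 \<wr> S\<^sub>n\<close>, and the presentation on \<open>a\<^sub>1, \<dots>, a\<^sub>n\<^sub>-\<^sub>1\<close> as one of the kernel of the sign. The first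
  is settled by counting, the second by an explicit inverse.

  For the first, the map to the wreath product is onto because the transpositions \<open>(1, i + 1)\<close> and
  \<open>\<gamma>\<^sup>(\<^sup>1\<^sup>)\<close> generate (\<open>wreath_generate\<close>). It is therefore an isomorphism once the Coxeter group has at
  most \<open>2\<^sup>n n!\<close> elements. In any group with elements \<open>s\<^sub>0, \<dots>, s\<^sub>n\<^sub>-\<^sub>1\<close> satisfying the Coxeter relations,
  the subgroup generated by \<open>s\<^sub>0, \<dots>, s\<^sub>m\<close> is a union of \<open>2 (m + 1)\<close> cosets of the one generated by
  \<open>s\<^sub>0, \<dots>, s\<^sub>m\<^sub>-\<^sub>1\<close>. The representatives are the prefixes of the word
  \<open>s\<^sub>m \<dots> s\<^sub>1 s\<^sub>0 s\<^sub>1 \<dots> s\<^sub>m\<close> (\<open>zigzag_word_shift\<close>, \<open>parabolic_subgroup_cosets\<close>).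

  For the second, let \<open>G\<close> be the group presented by the \<open>a\<^sub>i\<close> and \<open>C\<close> the Coxeter group. The elements
  \<open>(\<gamma>\<^sup>(\<^sup>1\<^sup>), (1, i + 1))\<close> satisfy the relations (\<open>wreath_alt_B_relations\<close>), which gives
  \<open>\<phi> : G \<rightarrow> C\<close>. Conjugation by \<open>s\<^sub>0\<close> inverts each of these elements, and the relations of \<open>G\<close> are
  stable under \<open>a\<^sub>i \<mapsto> a\<^sub>i\<^sup>-\<^sup>1\<close> (\<open>inverse_relations\<close>); so \<open>G\<close> has an involution \<open>\<theta>\<close> that behaves like
  conjugation by \<open>s\<^sub>0\<close>, and one can form the semidirect product \<open>K = G \<rtimes> \<langle>\<theta>\<rangle>\<close>. In \<open>K\<close> the elements
  \<open>\<theta> a\<^sub>i\<close> behave like the transpositions \<open>(1, i + 1)\<close> (\<open>star_relations_extension\<close>), hence \<open>K\<close> contains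
  elements satisfying the Coxeter relations (\<open>coxeter_gen_type_B\<close>). This yields \<open>\<psi> : C \<rightarrow> K\<close> with
  \<open>\<psi> \<circ> \<phi>\<close> the inclusion of \<open>G\<close>, so \<open>\<phi>\<close> is injective. Conversely \<open>\<phi>\<close> extends to \<open>\<chi> : K \<rightarrow> C\<close> by
  \<open>\<theta> \<mapsto> s\<^sub>0\<close>, and \<open>\<chi> \<circ> \<psi>\<close> is the identity, so that every element of \<open>C\<close> lies in \<open>\<phi>(G)\<close> or in
  \<open>\<phi>(G) s\<^sub>0\<close>. The sign tells these two cosets apart, and the image of \<open>\<phi>\<close> is exactly its kernel.
\<close>

section \<open>Presented groups\<close>

lemma pres_gen_closed: "x \<in> S \<Longrightarrow> pres_gen S R x \<in> carrier (presented_group S R)"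
  unfolding pres_gen_def presented_group_carrier by (rule imageI) simp

lemma word_value_pres_gen:
  assumes "w \<in> gwords S"
  shows "word_value (presented_group S R) (pres_gen S R) w = pres_rel S R `` {w}"
proof -
  interpret P: group "presented_group S R" by (rule group_presented_group)
  have inv: "inv\<^bsub>presented_group S R\<^esub> (pres_gen S R x) = pres_rel S R `` {[(x, False)]}"
    if "x \<in> S" for x
  proof (rule P.inv_equality)
    have "pres_eq S R [(x, False), (x, True)] []"
      using pres_eq.cancel[of "[]" S "[]" x R False] that by simp
    then show "pres_rel S R `` {[(x, False)]} \<otimes>\<^bsub>presented_group S R\<^esub> pres_gen S R x
        = \<one>\<^bsub>presented_group S R\<^esub>"
      using that by (simp add: pres_gen_def presented_group_mult pres_class_eq_iff)
        (simp add: presented_group_def pres_class_eq_iff)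
  next
    show "pres_rel S R `` {[(x, False)]} \<in> carrier (presented_group S R)"
      unfolding presented_group_carrier using that by (intro imageI) simp
  qed (use that in \<open>simp add: pres_gen_closed\<close>)
  show ?thesis using assms
  proof (induction w)
    case Nil
    then show ?case by (simp add: presented_group_def)
  next
    case (Cons p w)
    obtain x b where p: "p = (x, b)" by (cases p)
    have "(if b then pres_gen S R x else inv\<^bsub>presented_group S R\<^esub> (pres_gen S R x))
        = pres_rel S R `` {[(x, b)]}"
      using Cons.prems p inv by (auto simp: pres_gen_def)
    then show ?case using Cons p
      by (simp add: presented_group_mult)
  qed
qed

lemma pres_gen_relation:
  assumes "(l, r) \<in> R" "l \<in> gwords S" "r \<in> gwords S"
  shows "word_value (presented_group S R) (pres_gen S R) l
    = word_value (presented_group S R) (pres_gen S R) r"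
  using assms pres_eq.relation[of "[]" S "[]" l r R]
  by (simp add: word_value_pres_gen pres_class_eq_iff)

lemma hom_word_value:
  assumes "group G" "group H" "h \<in> hom G H" "f \<in> S \<rightarrow> carrier G" "w \<in> gwords S"
    and "\<And>x. x \<in> S \<Longrightarrow> h (f x) = f' x"
  shows "h (word_value G f w) = word_value H f' w"
proof -
  interpret group_hom G H h
    using assms(1-3) by (simp add: group_hom_def group_hom_axioms_def)
  show ?thesis using assms(5)
  proof (induction w)
    case (Cons p w)
    then have "fst p \<in> S" "w \<in> gwords S" by auto
    moreover have "word_value G f w \<in> carrier G"
      using G.word_value_closed[OF assms(4)] Cons by auto
    moreover have "f (fst p) \<in> carrier G" using assms(4) \<open>fst p \<in> S\<close> by auto
    ultimately show ?case using Cons assms(6) by (cases p) auto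
  qed simp
qed

lemma presented_group_carrier_words:
  "carrier (presented_group S R)
    = word_value (presented_group S R) (pres_gen S R) ` gwords S"
  by (auto simp: presented_group_carrier word_value_pres_gen image_def)

lemma presented_group_hom_eq:
  assumes "group H" "h \<in> hom (presented_group S R) H" "h' \<in> hom (presented_group S R) H"
    and "\<And>x. x \<in> S \<Longrightarrow> h (pres_gen S R x) = h' (pres_gen S R x)"
    and "X \<in> carrier (presented_group S R)"
  shows "h X = h' X"
proof -
  obtain w where w: "w \<in> gwords S" "X = word_value (presented_group S R) (pres_gen S R) w"
    using assms(5) by (auto simp: presented_group_carrier_words)
  have f: "pres_gen S R \<in> S \<rightarrow> carrier (presented_group S R)" by (simp add: pres_gen_closed)
  show ?thesis unfolding w(2)
    using hom_word_value[OF group_presented_group assms(1,2) f w(1), of "\<lambda>x. h' (pres_gen S R x)"]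
      hom_word_value[OF group_presented_group assms(1,3) f w(1), of "\<lambda>x. h' (pres_gen S R x)"]
      assms(4) by simp
qed

lemma presented_group_generate:
  "carrier (presented_group S R) \<subseteq> generate (presented_group S R) (pres_gen S R ` S)"
proof
  fix X assume "X \<in> carrier (presented_group S R)"
  then obtain w where w: "w \<in> gwords S" "X = word_value (presented_group S R) (pres_gen S R) w"
    by (auto simp: presented_group_carrier_words)
  have "word_value (presented_group S R) (pres_gen S R) w
      \<in> generate (presented_group S R) (pres_gen S R ` S)"
    using w(1)
  proof (induction w)
    case (Cons p w)
    then show ?case
      by (cases p) (auto intro!: generate.eng intro: generate.incl generate.inv)
  qed (simp add: generate.one)
  then show "X \<in> generate (presented_group S R) (pres_gen S R ` S)" using w by simp
qed

section \<open>The order of the Coxeter group\<close>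

text \<open>The Coxeter relations between elements of an arbitrary group. They serve twice: in the Coxeter
  group, to bound its order, and in a semidirect product, to map the Coxeter group into it.\<close>

locale type_B_relations = group +
  fixes n :: nat and s :: "nat \<Rightarrow> 'a"
  assumes s_closed: "i < n \<Longrightarrow> s i \<in> carrier G"
    and s_square: "i < n \<Longrightarrow> s i \<otimes> s i = \<one>"
    and s_quad: "1 < n \<Longrightarrow> s 0 \<otimes> (s 1 \<otimes> (s 0 \<otimes> s 1)) = s 1 \<otimes> (s 0 \<otimes> (s 1 \<otimes> s 0))"
    and s_braid: "1 \<le> i \<Longrightarrow> i + 1 < n
      \<Longrightarrow> s i \<otimes> (s (i + 1) \<otimes> s i) = s (i + 1) \<otimes> (s i \<otimes> s (i + 1))"
    and s_commute: "i + 1 < j \<Longrightarrow> j < n \<Longrightarrow> s i \<otimes> s j = s j \<otimes> s i"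
begin

text \<open>The sequence \<open>m, \<dots>, 1, 0, 1, \<dots>, m\<close> of indices. Geometrically, the word \<open>s\<^sub>m \<dots> s\<^sub>0 \<dots> s\<^sub>m\<close> walks
  the point \<open>m + 1\<close> through the positions \<open>m, \<dots>, 1, -1, \<dots>, -(m + 1)\<close> of the signed permutation
  action, and its \<open>2 m + 2\<close> prefixes represent the cosets of the stabiliser of \<open>m + 1\<close>.\<close>

definition zigzag :: "nat \<Rightarrow> nat \<Rightarrow> nat"
  where "zigzag m k = (if k \<le> m then m - k else k - m)"

primrec zigzag_word :: "nat \<Rightarrow> nat \<Rightarrow> 'a" where
  "zigzag_word m 0 = \<one>"
| "zigzag_word m (Suc k) = zigzag_word m k \<otimes> s (zigzag m k)"

lemma s_left_cancel: "i < n \<Longrightarrow> x \<in> carrier G \<Longrightarrow> x \<otimes> s i \<otimes> s i = x"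
  by (simp add: m_assoc s_closed s_square)

lemma s_braid':
  assumes "1 \<le> i" "1 \<le> j" "i < n" "j < n" "i = j + 1 \<or> j = i + 1"
  shows "s i \<otimes> (s j \<otimes> s i) = s j \<otimes> (s i \<otimes> s j)"
  using assms s_braid[of i] s_braid[of j] by auto

lemma s_commute':
  assumes "i < n" "j < n" "i + 1 < j \<or> j + 1 < i"
  shows "s i \<otimes> s j = s j \<otimes> s i"
  using assms s_commute[of i j] s_commute[of j i] by auto

lemma zigzag_less: "m < n \<Longrightarrow> k \<le> 2 * m \<Longrightarrow> zigzag m k < n"
  by (auto simp: zigzag_def)

lemma zigzag_word_closed: "m < n \<Longrightarrow> k \<le> 2 * m + 1 \<Longrightarrow> zigzag_word m k \<in> carrier G"
  by (induction k) (auto simp: s_closed zigzag_less)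

text \<open>A generator that neither prolongs nor shortens the prefix \<open>w\<close> of the zigzag word can be carried
  through it to the left. The reason is local. If it does not commute with the last letter, it
  must be the letter before that one, and then a braid relation turns \<open>\<dots> i z i\<close> into
  \<open>\<dots> z i z\<close>, after which \<open>z\<close> is carried through a shorter prefix. At the turning point
  \<open>1 0 1\<close> the braid relation is replaced by the relation between \<open>s\<^sub>0\<close> and \<open>s\<^sub>1\<close>.\<close>

lemma zigzag_word_shift:
  assumes "m < n" "k \<le> 2 * m + 1" "i \<le> m" "i \<noteq> zigzag m k" "0 < k \<Longrightarrow> i \<noteq> zigzag m (k - 1)"
  shows "\<exists>j<m. zigzag_word m k \<otimes> s i = s j \<otimes> zigzag_word m k"
  using assms(2-5)
proof (induction k arbitrary: i rule: less_induct)
  case (less k)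
  show ?case
  proof (cases k)
    case 0
    then show ?thesis using less.prems assms(1)
      by (intro exI[of _ i]) (auto simp: zigzag_def s_closed)
  next
    case (Suc k')
    let ?w = "zigzag_word m" and ?z = "zigzag m"
    have i: "i < n" "s i \<in> carrier G" using less.prems assms(1) by (auto simp: s_closed)
    have wc: "?w l \<in> carrier G" if "l \<le> 2 * m + 1" for l
      using that assms(1) by (simp add: zigzag_word_closed)
    have zc: "?z l < n" "s (?z l) \<in> carrier G" if "l \<le> 2 * m" for l
      using that assms(1) by (auto simp: s_closed zigzag_less)
    have k': "k' \<le> 2 * m" using less.prems Suc by simp
    have ne: "i \<noteq> ?z k'" "i \<noteq> ?z (Suc k')" using less.prems Suc by auto
    consider (far) "i + 1 < ?z k' \<or> ?z k' + 1 < i" | (near) "?z k' = i + 1 \<or> i = ?z k' + 1"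
      using ne by linarith
    then show ?thesis
    proof cases
      case far
      have "i \<noteq> ?z (k' - 1)" if "0 < k'"
        using far that by (auto simp: zigzag_def split: if_splits)
      then obtain j where j: "j < m" "?w k' \<otimes> s i = s j \<otimes> ?w k'"
        using less.IH[of k' i] Suc less.prems ne k' by auto
      have "?w k \<otimes> s i = ?w k' \<otimes> s i \<otimes> s (?z k')"
        using far i zc[OF k'] wc[of k'] k' s_commute'[of i "?z k'"] Suc by (simp add: m_assoc)
      also have "\<dots> = s j \<otimes> ?w k"
        using j assms(1) wc[of k'] zc[OF k'] k' Suc by (simp add: m_assoc s_closed)
      finally show ?thesis using j by auto
    next
      case near
      have k0: "0 < k'" "k' \<noteq> m"
        using near ne less.prems(2) by (auto simp: zigzag_def split: if_splits)
      then obtain l where l: "k' = Suc l" by (cases k') auto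
      have il: "i = ?z l"
        using near ne(2) k0(2) unfolding l zigzag_def by (auto split: if_splits)
      show ?thesis
      proof (cases "l = m")
        case False
        have pos: "1 \<le> i" "1 \<le> ?z k'"
          using il l k0 False by (auto simp: zigzag_def)
        have "?z k' \<noteq> ?z l" "0 < l \<longrightarrow> ?z k' \<noteq> ?z (l - 1)" "?z k' \<le> m"
          using False k0 l k' near by (auto simp: zigzag_def split: if_splits)
        then obtain j where j: "j < m" "?w l \<otimes> s (?z k') = s j \<otimes> ?w l"
          using less.IH[of l "?z k'"] Suc l less.prems k' by auto
        have jc: "s j \<in> carrier G" using j assms(1) by (simp add: s_closed)
        have braid: "s i \<otimes> (s (?z k') \<otimes> s i) = s (?z k') \<otimes> (s i \<otimes> s (?z k'))"
          using near by (intro s_braid'[OF pos i(1) zc(1)[OF k']]) auto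
        have "?w k \<otimes> s i = ?w l \<otimes> (s i \<otimes> (s (?z k') \<otimes> s i))"
          using Suc l il i zc[OF k'] wc[of l] k' by (simp add: m_assoc)
        also have "\<dots> = ?w l \<otimes> s (?z k') \<otimes> (s i \<otimes> s (?z k'))"
          using braid i zc[OF k'] wc[of l] k' l by (simp add: m_assoc)
        also have "\<dots> = s j \<otimes> ?w k"
          using j jc wc[of l] zc[OF k'] i k' Suc l il by (simp add: m_assoc)
        finally show ?thesis using j by auto
      next
        case True
        \<comment> \<open>The prefix ends in \<open>s 1 \<otimes> s 0 \<otimes> s 1\<close>, and multiplication by \<open>s 0\<close> completes the longest
          element of the dihedral group of order 8.\<close>
        then obtain p where p: "l = Suc p" using k' l by (cases l) auto
        have z: "i = 0" "?z k' = 1" "?z p = 1" "?z l = 0"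
          using True p l il by (auto simp: zigzag_def)
        have m1: "1 < n" "1 \<le> m" using True p assms(1) by auto
        have "\<exists>j<m. ?w p \<otimes> s 0 = s j \<otimes> ?w p"
          using less.IH[of p 0] Suc l p less.prems True by (auto simp: zigzag_def)
        then obtain j where j: "j < m" "?w p \<otimes> s 0 = s j \<otimes> ?w p" by auto
        have c: "s 0 \<in> carrier G" "s 1 \<in> carrier G" "s j \<in> carrier G" "?w p \<in> carrier G"
          using m1 j assms(1) wc[of p] True p by (auto simp: s_closed)
        have wk: "?w k = ?w p \<otimes> (s 1 \<otimes> (s 0 \<otimes> s 1))"
          using Suc l p z c by (simp add: m_assoc)
        have "?w k \<otimes> s i = ?w p \<otimes> (s 1 \<otimes> (s 0 \<otimes> (s 1 \<otimes> s 0)))"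
          using wk z c by (simp add: m_assoc)
        also have "\<dots> = ?w p \<otimes> s 0 \<otimes> (s 1 \<otimes> (s 0 \<otimes> s 1))"
          using s_quad m1 c by (simp add: m_assoc)
        also have "\<dots> = s j \<otimes> ?w k"
          using j(2) c wk by (simp add: m_assoc)
        finally show ?thesis using j by auto
      qed
    qed
  qed
qed

lemma gens_closed: "m \<le> n \<Longrightarrow> s ` {..<m} \<subseteq> carrier G"
  by (auto simp: s_closed)

lemma parabolic_subgroup_cosets:
  assumes "m < n"
  shows "generate G (s ` {..<Suc m})
    \<subseteq> (\<Union>k\<in>{..2 * m + 1}. generate G (s ` {..<m}) #> zigzag_word m k)" (is "_ \<subseteq> ?U")
proof -
  let ?H = "generate G (s ` {..<m})" and ?w = "zigzag_word m"
  have sub: "subgroup ?H G" using assms by (intro generate_is_subgroup gens_closed) simp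
  have Hc: "h \<in> carrier G" if "h \<in> ?H" for h using that sub subgroup.mem_carrier by metis
  have wc: "?w k \<in> carrier G" if "k \<le> 2 * m + 1" for k
    using that assms by (simp add: zigzag_word_closed)
  have U: "h \<otimes> ?w k \<in> ?U" if "h \<in> ?H" "k \<le> 2 * m + 1" for h k
    using that by (auto simp: r_coset_def)
  have step: "u \<otimes> s i \<in> ?U" if uU: "u \<in> ?U" and im: "i \<le> m" for u i
  proof -
    obtain h k where u: "u = h \<otimes> ?w k" and h: "h \<in> ?H" and k: "k \<le> 2 * m + 1"
      using uU unfolding r_coset_def by blast
    have ic: "i < n" "s i \<in> carrier G" using im assms by (auto simp: s_closed)
    have us: "u \<otimes> s i = h \<otimes> (?w k \<otimes> s i)" using u Hc[OF h] wc[OF k] ic by (simp add: m_assoc)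
    consider "i = zigzag m k" | k' where "k = Suc k'" "i = zigzag m k'"
      | "i \<noteq> zigzag m k" "0 < k \<longrightarrow> i \<noteq> zigzag m (k - 1)"
      by (cases k) auto
    then show ?thesis
    proof cases
      case 1
      then have "Suc k \<le> 2 * m + 1" using im k by (auto simp: zigzag_def split: if_splits)
      then show ?thesis using U[OF h, of "Suc k"] 1 us by simp
    next
      case 2
      then have "?w k \<otimes> s i = ?w k'" using s_left_cancel ic wc[of k'] k by simp
      then show ?thesis using U[OF h, of k'] 2 us k by simp
    next
      case 3
      then obtain j where j: "j < m" "?w k \<otimes> s i = s j \<otimes> ?w k"
        using zigzag_word_shift[OF assms k] im by auto
      then have "s j \<in> ?H" by (auto intro: generate.incl)
      then have "h \<otimes> s j \<in> ?H" using h by (intro generate.eng)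
      moreover have "u \<otimes> s i = h \<otimes> s j \<otimes> ?w k"
        using us j Hc[OF h] wc[OF k] Hc[OF \<open>s j \<in> ?H\<close>] by (simp add: m_assoc)
      ultimately show ?thesis using U k by simp
    qed
  qed
  have Uc: "u \<in> carrier G" if "u \<in> ?U" for u
    using that Hc wc by (auto simp: r_coset_def)
  have gc: "x \<in> carrier G" if "x \<in> generate G (s ` {..<Suc m})" for x
    using that assms generate_in_carrier[OF gens_closed[of "Suc m"]] by auto
  have "u \<otimes> x \<in> ?U" if "x \<in> generate G (s ` {..<Suc m})" "u \<in> ?U" for x u
    using that
  proof (induction arbitrary: u)
    case one
    then show ?case using Uc by simp
  next
    case (incl x)
    then obtain i where "x = s i" "i \<le> m" by (auto simp: less_Suc_eq_le)
    then show ?case using step[OF incl.prems] by (simp only:)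
  next
    case (inv x)
    then obtain i where i: "x = s i" "i \<le> m" by (auto simp: less_Suc_eq_le)
    then have "inv\<^bsub>G\<^esub> x = x" using assms s_square[of i] s_closed[of i] by (intro inv_equality) auto
    then show ?case using step[OF inv.prems] i by (simp only:)
  next
    case (eng x y)
    then have "u \<otimes> x \<otimes> y \<in> ?U" by blast
    then show ?case using eng.prems Uc gc eng.hyps by (simp add: m_assoc)
  qed
  moreover have "\<one> \<in> ?U" using U[of \<one> 0] by (simp add: generate.one)
  ultimately show ?thesis using gc by (metis l_one subsetI)
qed

lemma parabolic_subgroup_card:
  "m \<le> n \<Longrightarrow> finite (generate G (s ` {..<m})) \<and> card (generate G (s ` {..<m})) \<le> 2 ^ m * fact m"
proof (induction m)
  case 0
  then show ?case by (simp add: generate_empty)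
next
  case (Suc m)
  let ?H = "generate G (s ` {..<m})" and ?w = "zigzag_word m"
  let ?U = "\<Union>k\<in>{..2 * m + 1}. ?H #> ?w k"
  have H: "finite ?H" "card ?H \<le> 2 ^ m * fact m" using Suc by auto
  have coset: "?H #> x = (\<lambda>h. h \<otimes> x) ` ?H" for x by (auto simp: r_coset_def)
  have fin: "finite ?U" using H coset by auto
  have "card ?U \<le> (\<Sum>k\<in>{..2 * m + 1}. card (?H #> ?w k))"
    by (rule card_UN_le) simp
  also have "\<dots> \<le> (\<Sum>k\<in>{..2 * m + 1}. 2 ^ m * fact m)"
    unfolding coset by (intro sum_mono le_trans[OF card_image_le[OF H(1)] H(2)])
  also have "\<dots> = 2 ^ Suc m * fact (Suc m)" by (simp add: algebra_simps)
  finally have "card ?U \<le> 2 ^ Suc m * fact (Suc m)" .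
  moreover have "generate G (s ` {..<Suc m}) \<subseteq> ?U"
    using parabolic_subgroup_cosets Suc.prems by simp
  ultimately show ?case using fin by (meson card_mono finite_subset le_trans)
qed

end

section \<open>Identification with the wreath product\<close>

lemma coxeter_B_gen_closed: "i < n \<Longrightarrow> coxeter_B_gen n i \<in> carrier (coxeter_B n)"
  unfolding coxeter_B_gen_def coxeter_B_def by (simp add: pres_gen_closed)

lemma group_coxeter_B: "group (coxeter_B n)"
  unfolding coxeter_B_def by (rule group_presented_group)

lemma coxeter_B_type_B_relations: "type_B_relations (coxeter_B n) n (coxeter_B_gen n)"
proof -
  interpret C: group "coxeter_B n" by (rule group_coxeter_B)
  have rel: "word_value (coxeter_B n) (coxeter_B_gen n) l = word_value (coxeter_B n) (coxeter_B_gen n) r"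
    if "(l, r) \<in> coxeter_B_rels n" "l \<in> gwords {..<n}" "r \<in> gwords {..<n}" for l r
    using pres_gen_relation[OF that] unfolding coxeter_B_def coxeter_B_gen_def[abs_def] .
  note c = coxeter_B_gen_closed
  show ?thesis
  proof
    fix i assume "i < n"
    then show "coxeter_B_gen n i \<in> carrier (coxeter_B n)" by (rule c)
    have "(word_power (letter i) 2, []) \<in> coxeter_B_rels n"
      using \<open>i < n\<close> by (auto simp: coxeter_B_rels_def)
    from rel[OF this] show "coxeter_B_gen n i \<otimes>\<^bsub>coxeter_B n\<^esub> coxeter_B_gen n i = \<one>\<^bsub>coxeter_B n\<^esub>"
      using \<open>i < n\<close> by (simp add: word_power_def numeral_2_eq_2 c)
  next
    assume "1 < n"
    have "(letter 0 @ letter 1 @ letter 0 @ letter 1, letter 1 @ letter 0 @ letter 1 @ letter 0)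
        \<in> coxeter_B_rels n"
      by (auto simp: coxeter_B_rels_def)
    from rel[OF this] show "coxeter_B_gen n 0 \<otimes>\<^bsub>coxeter_B n\<^esub> (coxeter_B_gen n 1 \<otimes>\<^bsub>coxeter_B n\<^esub>
        (coxeter_B_gen n 0 \<otimes>\<^bsub>coxeter_B n\<^esub> coxeter_B_gen n 1)) = coxeter_B_gen n 1 \<otimes>\<^bsub>coxeter_B n\<^esub>
        (coxeter_B_gen n 0 \<otimes>\<^bsub>coxeter_B n\<^esub> (coxeter_B_gen n 1 \<otimes>\<^bsub>coxeter_B n\<^esub> coxeter_B_gen n 0))"
      using \<open>1 < n\<close> by (simp add: c)
  next
    fix i :: nat assume i: "1 \<le> i" "i + 1 < n"
    have "(letter i @ letter (i + 1) @ letter i, letter (i + 1) @ letter i @ letter (i + 1))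
        \<in> coxeter_B_rels n"
      using i by (auto simp: coxeter_B_rels_def)
    from rel[OF this] show "coxeter_B_gen n i \<otimes>\<^bsub>coxeter_B n\<^esub>
        (coxeter_B_gen n (i + 1) \<otimes>\<^bsub>coxeter_B n\<^esub> coxeter_B_gen n i) = coxeter_B_gen n (i + 1)
        \<otimes>\<^bsub>coxeter_B n\<^esub> (coxeter_B_gen n i \<otimes>\<^bsub>coxeter_B n\<^esub> coxeter_B_gen n (i + 1))"
      using i by (simp add: c)
  next
    fix i j :: nat assume i: "i + 1 < j" "j < n"
    then have "(letter i @ letter j, letter j @ letter i) \<in> coxeter_B_rels n"
      by (auto simp: coxeter_B_rels_def)
    from rel[OF this] show "coxeter_B_gen n i \<otimes>\<^bsub>coxeter_B n\<^esub> coxeter_B_gen n j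
        = coxeter_B_gen n j \<otimes>\<^bsub>coxeter_B n\<^esub> coxeter_B_gen n i"
      using i by (simp add: c)
  qed
qed

context type_B_relations
begin

lemma word_value_coxeter_B_rels:
  assumes "n \<ge> 2" "(l, r) \<in> coxeter_B_rels n"
  shows "word_value G s l = word_value G s r"
proof -
  consider (sq) i where "i < n" "l = letter i @ letter i" "r = []"
    | (br0) "l = letter 0 @ letter 1 @ letter 0 @ letter 1" "r = letter 1 @ letter 0 @ letter 1 @ letter 0"
    | (br) i where "1 \<le> i" "i + 1 < n" "l = letter i @ letter (i + 1) @ letter i"
        "r = letter (i + 1) @ letter i @ letter (i + 1)"
    | (comm) i j where "i < n" "j < n" "\<bar>int i - int j\<bar> > 1" "l = letter i @ letter j"
        "r = letter j @ letter i"
    using assms(2) by (auto simp: coxeter_B_rels_def word_power_def numeral_2_eq_2)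
  then show ?thesis
  proof cases
    case sq
    then show ?thesis by (simp add: s_closed s_square)
  next
    case br0
    then show ?thesis using s_quad assms(1) s_closed[of 0] s_closed[of 1] by simp
  next
    case br
    then show ?thesis using s_braid[of i] s_closed[of i] s_closed[of "i + 1"] by simp
  next
    case comm
    then have "i + 1 < j \<or> j + 1 < i" by linarith
    then show ?thesis using comm s_commute'[of i j] s_closed[of i] s_closed[of j] by simp
  qed
qed

lemma coxeter_B_lift:
  assumes "n \<ge> 2"
  shows "pres_lift G s \<in> hom (coxeter_B n) G"
    and "i < n \<Longrightarrow> pres_lift G s (coxeter_B_gen n i) = s i"
proof -
  have f: "s \<in> {..<n} \<rightarrow> carrier G" by (simp add: s_closed)
  note R = word_value_coxeter_B_rels[OF assms]
  show "pres_lift G s \<in> hom (coxeter_B n) G"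
    unfolding coxeter_B_def by (rule pres_lift_hom[OF f R])
  show "i < n \<Longrightarrow> pres_lift G s (coxeter_B_gen n i) = s i"
    unfolding coxeter_B_gen_def by (rule pres_lift_gen[OF f R]) auto
qed

end

lemma coxeter_B_card:
  "finite (carrier (coxeter_B n))" "card (carrier (coxeter_B n)) \<le> 2 ^ n * fact n"
proof -
  interpret C: type_B_relations "coxeter_B n" n "coxeter_B_gen n"
    by (rule coxeter_B_type_B_relations)
  have "carrier (coxeter_B n) = generate (coxeter_B n) (coxeter_B_gen n ` {..<n})"
    using presented_group_generate[of "{..<n}" "coxeter_B_rels n"] C.generate_in_carrier[OF C.gens_closed]
    by (auto simp: coxeter_B_def coxeter_B_gen_def[abs_def])
  then show "finite (carrier (coxeter_B n))" "card (carrier (coxeter_B n)) \<le> 2 ^ n * fact n"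
    using C.parabolic_subgroup_card[of n] by auto
qed

lemma coxeter_B_hom_eq:
  assumes "group H" "h \<in> hom (coxeter_B n) H" "h' \<in> hom (coxeter_B n) H"
    and "\<And>i. i < n \<Longrightarrow> h (coxeter_B_gen n i) = h' (coxeter_B_gen n i)"
    and "x \<in> carrier (coxeter_B n)"
  shows "h x = h' x"
  using presented_group_hom_eq[OF assms(1), of h "{..<n}" "coxeter_B_rels n" h' x] assms(2-)
  by (auto simp: coxeter_B_def coxeter_B_gen_def)

text \<open>If \<open>s i\<close> is the transposition \<open>(i, i + 1)\<close>, this is \<open>(1, i + 1)\<close>. The index 0 does not denote a
  transposition; its value is only there to make the function total.\<close>

primrec star_transp :: "('a, 'b) monoid_scheme \<Rightarrow> (nat \<Rightarrow> 'a) \<Rightarrow> nat \<Rightarrow> 'a" where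
  "star_transp G s 0 = \<one>\<^bsub>G\<^esub>"
| "star_transp G s (Suc i) =
    (if i = 0 then s 1 else s (Suc i) \<otimes>\<^bsub>G\<^esub> (star_transp G s i \<otimes>\<^bsub>G\<^esub> s (Suc i)))"

lemma star_transp_closed:
  assumes "group G" "\<And>i. i < n \<Longrightarrow> s i \<in> carrier G"
  shows "i < n \<Longrightarrow> star_transp G s i \<in> carrier G"
proof (induction i)
  case (Suc i)
  then show ?case using assms by (simp add: group.is_monoid monoid.m_closed)
qed (use assms in \<open>simp add: group.is_monoid monoid.one_closed\<close>)

lemma hom_star_transp:
  assumes "group G" "group H" "h \<in> hom G H" "\<And>i. i < n \<Longrightarrow> s i \<in> carrier G"
    and "\<And>i. i < n \<Longrightarrow> h (s i) = s' i"
  shows "i < n \<Longrightarrow> h (star_transp G s i) = star_transp H s' i"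
proof -
  interpret group_hom G H h using assms(1-3) by (simp add: group_hom_def group_hom_axioms_def)
  note c = star_transp_closed[of G n s, OF assms(1,4)]
  show "i < n \<Longrightarrow> ?thesis"
  proof (induction i)
    case (Suc i)
    then show ?case using assms(4,5) c[of i] by simp
  qed simp
qed

lemma wreath_mult: "(g, \<pi>) \<otimes>\<^bsub>wreath_C2 n\<^esub> (h, \<sigma>) = (g \<otimes>\<^bsub>C2_pow n\<^esub> perm_act n \<pi> h, \<pi> \<circ> \<sigma>)"
  by (simp add: wreath_C2_def sym_group_mult)

lemma wreath_one: "\<one>\<^bsub>wreath_C2 n\<^esub> = (\<one>\<^bsub>C2_pow n\<^esub>, id)"
  by (simp add: wreath_C2_def sym_group_one)

lemma wreath_carrier:
  "(g, \<pi>) \<in> carrier (wreath_C2 n) \<longleftrightarrow> g \<in> carrier (C2_pow n) \<and> \<pi> permutes {1..n}"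
  by (simp add: wreath_C2_def sym_group_carrier)

lemma C2_pow_one_mult [simp]:
  "g \<in> carrier (C2_pow n) \<Longrightarrow> \<one>\<^bsub>C2_pow n\<^esub> \<otimes>\<^bsub>C2_pow n\<^esub> g = g"
  "g \<in> carrier (C2_pow n) \<Longrightarrow> g \<otimes>\<^bsub>C2_pow n\<^esub> \<one>\<^bsub>C2_pow n\<^esub> = g"
  by (simp_all only: monoid.l_one monoid.r_one group.is_monoid[OF group_C2_pow])

lemma C2_pow_one_closed [simp]: "\<one>\<^bsub>C2_pow n\<^esub> \<in> carrier (C2_pow n)"
  by (rule monoid.one_closed[OF group.is_monoid[OF group_C2_pow]])

lemma star_transp_wreath:
  "1 \<le> i \<Longrightarrow> i < n \<Longrightarrow>
    star_transp (wreath_C2 n) (wreath_gen n) i = (\<one>\<^bsub>C2_pow n\<^esub>, Transposition.transpose 1 (i + 1))"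
proof (induction i)
  case (Suc i)
  have t: "Transposition.transpose (Suc i) (Suc (Suc i)) permutes {1..n}"
    using Suc by (intro permutes_swap_id) auto
  show ?case
  proof (cases "i = 0")
    case True
    then show ?thesis by (simp add: wreath_gen_def)
  next
    case False
    have "Transposition.transpose 1 (i + 1) permutes {1..n}"
      using Suc.prems by (intro permutes_swap_id) auto
    moreover have "Transposition.transpose (Suc i) (Suc (Suc i)) \<circ>
        (Transposition.transpose 1 (i + 1) \<circ> Transposition.transpose (Suc i) (Suc (Suc i)))
        = Transposition.transpose 1 (Suc i + 1)"
      using False by (auto simp: fun_eq_iff Transposition.transpose_def)
    ultimately show ?thesis using Suc False t
      by (simp add: wreath_gen_def wreath_mult perm_act_one)
  qed
qed simp

text \<open>The transpositions \<open>(1, j)\<close> generate all transpositions by conjugation, hence all permutations, and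
  conjugate \<open>\<gamma>\<^sup>(\<^sup>1\<^sup>)\<close> into every \<open>\<gamma>\<^sup>(\<^sup>j\<^sup>)\<close>; products of the latter exhaust \<open>C\<^sub>2\<^sup>n\<close>.\<close>

lemma wreath_generate:
  assumes "n \<ge> 1"
  shows "carrier (wreath_C2 n) \<subseteq> generate (wreath_C2 n) (wreath_gen n ` {..<n})"
proof
  interpret W: group "wreath_C2 n" by (rule group_wreath_C2)
  let ?H = "generate (wreath_C2 n) (wreath_gen n ` {..<n})"
  let ?one = "\<one>\<^bsub>C2_pow n\<^esub>"
  have mult: "(g \<otimes>\<^bsub>C2_pow n\<^esub> perm_act n \<pi> h, \<pi> \<circ> \<sigma>) \<in> ?H" if "(g, \<pi>) \<in> ?H" "(h, \<sigma>) \<in> ?H" for g \<pi> h \<sigma>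
    using generate.eng[OF that] by (simp add: wreath_mult)
  have gen: "wreath_gen n i \<in> ?H" if "i < n" for i using that by (auto intro: generate.incl)
  have star: "star_transp (wreath_C2 n) (wreath_gen n) i \<in> ?H" if "i < n" for i
    using that
  proof (induction i)
    case (Suc i)
    then show ?case using gen[of 1] gen[of "Suc i"] by (auto intro: generate.eng)
  qed (simp add: generate.one)
  have one_in: "(?one, id) \<in> ?H" using generate.one[of "wreath_C2 n"] by (simp add: wreath_one)
  have t1: "(?one, Transposition.transpose 1 j) \<in> ?H" if "j \<in> {1..n}" for j
  proof (cases "j = 1")
    case True then show ?thesis using one_in by simp
  next
    case False
    then have "1 \<le> j - 1" "j - 1 < n" using that by auto
    then show ?thesis using star[of "j - 1"] star_transp_wreath[of "j - 1" n] that by simp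
  qed
  have perm_mult: "(?one, \<pi> \<circ> \<sigma>) \<in> ?H" if "(?one, \<pi>) \<in> ?H" "(?one, \<sigma>) \<in> ?H" "\<pi> permutes {1..n}" for \<pi> \<sigma>
    using mult[OF that(1,2)] that(3) by (simp add: perm_act_one)
  have tp: "Transposition.transpose a b permutes {1..n}" if "a \<in> {1..n}" "b \<in> {1..n}" for a b
    using that by (intro permutes_swap_id)
  have t: "(?one, Transposition.transpose a b) \<in> ?H" if ab: "a \<in> {1..n}" "b \<in> {1..n}" for a b
  proof -
    consider "a = 1" | "b = 1" | "a = b" | "a \<noteq> 1" "b \<noteq> 1" "a \<noteq> b" by blast
    then show ?thesis
    proof cases
      case 1 then show ?thesis using t1 ab by simp
    next
      case 2 then show ?thesis using t1[of a] ab by (simp add: transpose_commute)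
    next
      case 3 then show ?thesis using one_in by simp
    next
      case 4
      then have "Transposition.transpose a b = Transposition.transpose 1 a \<circ>
          (Transposition.transpose 1 b \<circ> Transposition.transpose 1 a)"
        by (auto simp: fun_eq_iff Transposition.transpose_def)
      moreover have "(?one, \<dots>) \<in> ?H"
        using ab assms by (intro perm_mult t1 tp) auto
      ultimately show ?thesis by simp
    qed
  qed
  have perm: "(?one, \<pi>) \<in> ?H" if "\<pi> permutes {1..n}" for \<pi>
    using that finite_atLeastAtMost
  proof (induction rule: permutes_induct)
    case id
    then show ?case by (rule one_in)
  next
    case (swap a b p)
    then show ?case by (intro perm_mult t tp)
  qed
  have gamma: "(gamma n j, id) \<in> ?H" if "j \<in> {1..n}" for j
  proof -
    let ?t = "Transposition.transpose 1 j"
    have "(gamma n 1, id) \<in> ?H"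
      using gen[of 0] assms by (simp add: wreath_gen_def sym_group_one)
    then have "(gamma n 1 \<otimes>\<^bsub>C2_pow n\<^esub> perm_act n id ?one, id \<circ> ?t) \<in> ?H"
      using t1[OF that] by (intro mult)
    then have "(gamma n 1, ?t) \<in> ?H" by (simp add: perm_act_id gamma_closed)
    then have "(?one \<otimes>\<^bsub>C2_pow n\<^esub> perm_act n ?t (gamma n 1), ?t \<circ> ?t) \<in> ?H"
      using t1[OF that] by (intro mult)
    moreover have "perm_act n ?t (gamma n 1) = gamma n j"
      using perm_act_gamma[of ?t n 1] tp[of 1 j] that by simp
    ultimately show ?thesis by (simp add: gamma_closed)
  qed
  have ind: "((\<lambda>i\<in>{1..n}. if i \<in> A then 1 else 0), id) \<in> ?H" if "A \<subseteq> {1..n}" for A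
    using finite_subset[OF that finite_atLeastAtMost] that
  proof (induction rule: finite_induct)
    case empty
    have "(\<lambda>i\<in>{1..n}. if i \<in> {} then 1 else (0 :: int)) = ?one" by (simp add: C2_pow_def)
    then show ?case using one_in by (simp only:)
  next
    case (insert j A)
    let ?\<chi> = "\<lambda>A. \<lambda>i\<in>{1..n}. if i \<in> A then 1 else (0 :: int)"
    have "?\<chi> A \<in> carrier (C2_pow n)"
      by (auto simp: C2_pow_def carrier_integer_mod_group)
    moreover have "gamma n j \<otimes>\<^bsub>C2_pow n\<^esub> ?\<chi> A = ?\<chi> (insert j A)"
      using insert by (auto simp: C2_pow_mult gamma_def C2_gen_def fun_eq_iff)
    moreover have "(gamma n j \<otimes>\<^bsub>C2_pow n\<^esub> perm_act n id (?\<chi> A), id \<circ> id) \<in> ?H"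
      using insert.prems by (intro mult gamma insert.IH) simp_all
    ultimately show ?case by (simp only: perm_act_id o_id)
  qed
  fix x assume "x \<in> carrier (wreath_C2 n)"
  then obtain g \<pi> where x: "x = (g, \<pi>)" "g \<in> carrier (C2_pow n)" "\<pi> permutes {1..n}"
    by (cases x) (auto simp: wreath_carrier)
  have "g i = 0 \<or> g i = 1" if "i \<in> {1..n}" for i
  proof -
    have "g i \<in> {0..<2}"
      using x(2) that by (simp add: C2_pow_def carrier_integer_mod_group PiE_iff)
    then show ?thesis by auto
  qed
  moreover have "g i = undefined" if "i \<notin> {1..n}" for i
    using x(2) that by (simp add: C2_pow_def PiE_iff extensional_def)
  moreover define A where "A = {i \<in> {1..n}. g i = 1}"
  ultimately have gA: "g = (\<lambda>i\<in>{1..n}. if i \<in> A then 1 else 0)"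
    by (auto simp: fun_eq_iff simp del: atLeastAtMost_iff)
  have "(g, id) \<in> ?H" by (subst gA, rule ind) (auto simp: A_def)
  then have "(g \<otimes>\<^bsub>C2_pow n\<^esub> perm_act n id ?one, id \<circ> \<pi>) \<in> ?H"
    using perm[OF x(3)] by (intro mult)
  then show "x \<in> ?H" using x by (simp add: perm_act_id)
qed

lemma wreath_card: "card (carrier (wreath_C2 n)) = 2 ^ n * fact n"
proof -
  have "card (carrier (C2_pow n)) = 2 ^ n"
    by (simp add: C2_pow_def card_PiE carrier_integer_mod_group)
  then show ?thesis
    by (simp add: wreath_C2_def card_cartesian_product sym_group_card_carrier)
qed

text \<open>A surjection from a group of at most \<open>2\<^sup>n n!\<close> elements onto one of exactly that order is
  injective.\<close>

lemma B_identification_iso: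
  assumes "n \<ge> 2"
  shows "B_identification n \<in> iso (coxeter_B n) (wreath_C2 n)"
proof -
  interpret group_hom "coxeter_B n" "wreath_C2 n" "B_identification n"
    using B_identification_hom[OF assms]
    by (simp add: group_hom_def group_hom_axioms_def group_coxeter_B group_wreath_C2)
  let ?f = "B_identification n"
  have "wreath_gen n ` {..<n} \<subseteq> ?f ` carrier (coxeter_B n)"
    using B_identification_gen[OF assms] coxeter_B_gen_closed by (force simp: image_iff)
  then have "generate (wreath_C2 n) (wreath_gen n ` {..<n}) \<subseteq> ?f ` carrier (coxeter_B n)"
    by (intro H.generate_subgroup_incl img_is_subgroup)
  then have surj: "?f ` carrier (coxeter_B n) = carrier (wreath_C2 n)"
    using wreath_generate[of n] assms by auto
  then have "card (carrier (coxeter_B n)) = card (?f ` carrier (coxeter_B n))"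
    using coxeter_B_card[of n] card_image_le[of "carrier (coxeter_B n)" ?f] wreath_card[of n] by simp
  then have "inj_on ?f (carrier (coxeter_B n))"
    using coxeter_B_card(1) by (intro eq_card_imp_inj_on) auto
  then show ?thesis using surj homh by (simp add: iso_def bij_betw_def)
qed

section \<open>The sign character\<close>

lemma C2_pow_sign_perm_act:
  assumes "\<pi> permutes {1..n}"
  shows "C2_pow_sign n (perm_act n \<pi> g) = C2_pow_sign n g"
proof -
  have inv: "Hilbert_Choice.inv \<pi> permutes {1..n}" using assms by (rule permutes_inv)
  have "C2_pow_sign n (perm_act n \<pi> g)
      = (\<Prod>i\<in>{1..n}. if g (Hilbert_Choice.inv \<pi> i) = C2_gen then -1 else 1)"
    unfolding C2_pow_sign_def by (rule prod.cong) (auto simp: perm_act_def)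
  also have "\<dots> = C2_pow_sign n g"
    unfolding C2_pow_sign_def
    using prod.permute[OF inv, of "\<lambda>i. if g i = C2_gen then -1 else 1 :: int"] by (simp add: o_def)
  finally show ?thesis .
qed

definition wreath_sign :: "nat \<Rightarrow> (nat \<Rightarrow> int) \<times> (nat \<Rightarrow> nat) \<Rightarrow> int"
  where "wreath_sign n x = C2_pow_sign n (fst x) * sign (snd x)"

lemma wreath_sign_hom: "wreath_sign n \<in> hom (wreath_C2 n) sign_img"
proof (rule homI)
  fix x assume "x \<in> carrier (wreath_C2 n)"
  then have "fst x \<in> carrier (C2_pow n)" "snd x \<in> carrier (sym_group n)"
    by (auto simp: wreath_C2_def)
  then have "C2_pow_sign n (fst x) \<in> carrier sign_img" "sign (snd x) \<in> carrier sign_img"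
    by (simp_all only: hom_in_carrier[OF C2_pow_sign_hom] hom_in_carrier[OF sign_is_hom])
  then show "wreath_sign n x \<in> carrier sign_img"
    by (auto simp: wreath_sign_def sign_img_def)
next
  fix x y assume xy: "x \<in> carrier (wreath_C2 n)" "y \<in> carrier (wreath_C2 n)"
  obtain g \<pi> h \<sigma> where x: "x = (g, \<pi>)" "y = (h, \<sigma>)" by (cases x, cases y)
  then have c: "g \<in> carrier (C2_pow n)" "h \<in> carrier (C2_pow n)" "\<pi> permutes {1..n}" "\<sigma> permutes {1..n}"
    using xy by (auto simp: wreath_carrier)
  have "C2_pow_sign n (g \<otimes>\<^bsub>C2_pow n\<^esub> perm_act n \<pi> h) = C2_pow_sign n g * C2_pow_sign n h"
    using hom_mult[OF C2_pow_sign_hom c(1) perm_act_closed[OF c(3,2)]] C2_pow_sign_perm_act[OF c(3)]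
    by (simp add: sign_img_def)
  moreover have "sign (\<pi> \<circ> \<sigma>) = sign \<pi> * (sign \<sigma> :: int)"
    using c permutation_permutes by (intro sign_compose) blast+
  ultimately show "wreath_sign n (x \<otimes>\<^bsub>wreath_C2 n\<^esub> y)
      = wreath_sign n x \<otimes>\<^bsub>sign_img\<^esub> wreath_sign n y"
    using x by (simp add: wreath_mult wreath_sign_def sign_img_def)
qed

text \<open>Both sides are homomorphisms with value \<open>-1\<close> on every generator.\<close>

lemma coxeter_B_sign_eq:
  assumes "n \<ge> 2" "x \<in> carrier (coxeter_B n)"
  shows "coxeter_B_sign n x = wreath_sign n (B_identification n x)"
proof (rule coxeter_B_hom_eq[OF sign_img_is_group coxeter_B_sign_hom _ _ assms(2)])
  show "(\<lambda>x. wreath_sign n (B_identification n x)) \<in> hom (coxeter_B n) sign_img"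
    using hom_compose[OF B_identification_hom[OF assms(1)] wreath_sign_hom] by (simp add: o_def)
  fix i assume i: "i < n"
  have "C2_pow_sign n \<one>\<^bsub>C2_pow n\<^esub> = 1"
    by (simp add: C2_pow_sign_def C2_pow_def C2_gen_def)
  then have "wreath_sign n (wreath_gen n i) = -1"
    using assms(1) by (auto simp: wreath_sign_def wreath_gen_def C2_pow_sign_gamma sym_group_one
        sign_swap_id sign_id)
  then show "coxeter_B_sign n (coxeter_B_gen n i)
      = wreath_sign n (B_identification n (coxeter_B_gen n i))"
    using i assms(1) by (simp add: coxeter_B_sign_gen B_identification_gen)
qed

lemma alternating_B_carrier:
  "carrier (alternating_B n) = {x \<in> carrier (coxeter_B n). coxeter_B_sign n x = 1}"
  by (auto simp: alternating_B_def kernel_def sign_img_def)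

lemma B_identification_alternating:
  assumes "n \<ge> 2"
  shows "B_identification n ` carrier (alternating_B n) = alternating_wreath n"
proof -
  have "carrier (wreath_C2 n) = B_identification n ` carrier (coxeter_B n)"
    using B_identification_iso[OF assms] by (auto simp: iso_def bij_betw_def)
  then have "B_identification n ` carrier (alternating_B n)
      = {y \<in> carrier (wreath_C2 n). wreath_sign n y = 1}"
    using coxeter_B_sign_eq[OF assms] by (auto simp: alternating_B_carrier image_iff)
  also have "\<dots> = alternating_wreath n"
    by (auto simp: alternating_wreath_def wreath_sign_def)
  finally show ?thesis .
qed

section \<open>Half turns in a dihedral group of order 8\<close>

text \<open>
  The following lemmas are about involutions \<open>e\<close>, \<open>p\<close>, \<open>q\<close>, \<open>r\<close> that in the wreath product would be
  \<open>\<gamma>\<^sup>(\<^sup>1\<^sup>)\<close>, \<open>(1, 2)\<close>, \<open>(1, i + 1)\<close> and \<open>(1, j + 1)\<close>, so that \<open>a\<^sub>1 = e p\<close>, \<open>a\<^sub>i = e q\<close> and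
  \<open>a\<^sub>j = e r\<close>. The element \<open>z = (e p)\<^sup>2 = a\<^sub>1\<^sup>2\<close> stands for \<open>\<gamma>\<^sup>(\<^sup>1\<^sup>) \<gamma>\<^sup>(\<^sup>2\<^sup>)\<close>; it is the half turn in the dihedral
  group generated by \<open>e\<close> and \<open>p\<close>. The relation \<open>(a\<^sub>1\<^sup>2 a\<^sub>i)\<^sup>2 = 1\<close> says precisely that \<open>z\<close> and \<open>e\<close> have
  the same effect on \<open>q\<close> by conjugation, and this converts the relations between the \<open>a\<^sub>i\<close> into
  relations between transpositions.
\<close>

context group
begin

lemma commute_mult:
  assumes "x \<in> carrier G" "y \<in> carrier G" "z \<in> carrier G" "x \<otimes> z = z \<otimes> x" "y \<otimes> z = z \<otimes> y"
  shows "(x \<otimes> y) \<otimes> z = z \<otimes> (x \<otimes> y)"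
  using assms by (metis m_assoc)

lemma square_cancel:
  "x \<in> carrier G \<Longrightarrow> y \<in> carrier G \<Longrightarrow> x \<otimes> x = \<one> \<Longrightarrow> x \<otimes> (x \<otimes> y) = y"
  by (simp flip: m_assoc)

lemma inverse_unique:
  "x \<in> carrier G \<Longrightarrow> y \<in> carrier G \<Longrightarrow> z \<in> carrier G \<Longrightarrow> x \<otimes> y = \<one> \<Longrightarrow> x \<otimes> z = \<one> \<Longrightarrow> y = z"
  by (metis inv_closed l_inv m_assoc l_one)

lemma half_turn_alt:
  assumes e: "e \<in> carrier G" "e \<otimes> e = \<one>" and p: "p \<in> carrier G" "p \<otimes> p = \<one>"
    and z: "z = e \<otimes> (p \<otimes> (e \<otimes> p))" "z \<otimes> z = \<one>"
  shows "z = p \<otimes> (e \<otimes> (p \<otimes> e))"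
proof -
  note cancel = square_cancel[OF p(1) _ p(2)] square_cancel[OF e(1) _ e(2)]
  have zc: "z \<in> carrier G" using e p z(1) by simp
  have "z \<otimes> (p \<otimes> (e \<otimes> (p \<otimes> e))) = \<one>"
    unfolding z(1) using p e by (simp add: m_assoc cancel)
  from inverse_unique[OF zc zc _ z(2) this] show ?thesis using p e by simp
qed

lemma half_turn_central:
  assumes e: "e \<in> carrier G" "e \<otimes> e = \<one>" and p: "p \<in> carrier G" "p \<otimes> p = \<one>"
    and z: "z = e \<otimes> (p \<otimes> (e \<otimes> p))" "z \<otimes> z = \<one>"
  shows "z \<otimes> e = e \<otimes> z" "z \<otimes> p = p \<otimes> z"
proof -
  note cancel = square_cancel[OF p(1) _ p(2)] square_cancel[OF e(1) _ e(2)]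
  note z' = half_turn_alt[OF assms]
  have "z \<otimes> e = (e \<otimes> (p \<otimes> (e \<otimes> p))) \<otimes> e" using z(1) by simp
  also have "\<dots> = e \<otimes> (p \<otimes> (e \<otimes> (p \<otimes> e)))" using e p by (simp add: m_assoc)
  finally show "z \<otimes> e = e \<otimes> z" using z' by simp
  have "z \<otimes> p = (p \<otimes> (e \<otimes> (p \<otimes> e))) \<otimes> p" using z' by simp
  also have "\<dots> = p \<otimes> (e \<otimes> (p \<otimes> (e \<otimes> p)))" using e p by (simp add: m_assoc)
  finally show "z \<otimes> p = p \<otimes> z" using z(1) by simp
qed

lemma half_turn_conj:
  assumes e: "e \<in> carrier G" "e \<otimes> e = \<one>" and p: "p \<in> carrier G" "p \<otimes> p = \<one>"
    and q: "q \<in> carrier G" "q \<otimes> q = \<one>"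
    and z: "z = e \<otimes> (p \<otimes> (e \<otimes> p))" "z \<otimes> z = \<one>"
    and square: "z \<otimes> (e \<otimes> (q \<otimes> (z \<otimes> (e \<otimes> q)))) = \<one>"
  shows "z \<otimes> (q \<otimes> z) = e \<otimes> (q \<otimes> e)"
proof -
  have zc: "z \<in> carrier G" using e p z(1) by simp
  have "z \<otimes> (e \<otimes> z) = e"
    using half_turn_central(1)[OF e p z] e zc z(2) by (metis square_cancel)
  moreover have "z \<otimes> (z \<otimes> (e \<otimes> (q \<otimes> (z \<otimes> (e \<otimes> q)))) \<otimes> (q \<otimes> z)) = z \<otimes> (q \<otimes> z)"
    using square q zc by simp
  ultimately show ?thesis
    using e q zc by (simp add: m_assoc square_cancel[OF zc _ z(2)] square_cancel[OF q(1) _ q(2)])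
qed

text \<open>Conjugating \<open>p q p\<close> by \<open>e\<close> replaces \<open>p\<close> by \<open>e p e = z p = p z\<close> and \<open>q\<close> by \<open>z q z\<close>; all factors \<open>z\<close>
  cancel.\<close>

lemma half_turn_commute:
  assumes e: "e \<in> carrier G" "e \<otimes> e = \<one>" and p: "p \<in> carrier G" "p \<otimes> p = \<one>"
    and q: "q \<in> carrier G" "q \<otimes> q = \<one>"
    and z: "z = e \<otimes> (p \<otimes> (e \<otimes> p))" "z \<otimes> z = \<one>"
    and conj: "z \<otimes> (q \<otimes> z) = e \<otimes> (q \<otimes> e)"
  shows "e \<otimes> (p \<otimes> (q \<otimes> p)) = (p \<otimes> (q \<otimes> p)) \<otimes> e"
proof -
  have zc: "z \<in> carrier G" using e p z(1) by simp
  note cancel = square_cancel[OF p(1) _ p(2)] square_cancel[OF e(1) _ e(2)]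
    square_cancel[OF zc _ z(2)]
  have P: "e \<otimes> (p \<otimes> e) = p \<otimes> z" "e \<otimes> (p \<otimes> e) = z \<otimes> p"
    using half_turn_alt[OF e p z] half_turn_central(2)[OF e p z] e p zc by (simp_all add: cancel)
  have "e \<otimes> (p \<otimes> (q \<otimes> p)) \<otimes> e = (e \<otimes> (p \<otimes> e)) \<otimes> ((e \<otimes> (q \<otimes> e)) \<otimes> (e \<otimes> (p \<otimes> e)))"
    using e p q by (simp add: m_assoc cancel)
  also have "\<dots> = (p \<otimes> z) \<otimes> ((z \<otimes> (q \<otimes> z)) \<otimes> (z \<otimes> p))"
    using P conj by metis
  also have "\<dots> = p \<otimes> (q \<otimes> p)"
    using p q zc by (simp add: m_assoc cancel)
  finally have "e \<otimes> (p \<otimes> (q \<otimes> p)) \<otimes> e \<otimes> e = p \<otimes> (q \<otimes> p) \<otimes> e" by simp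
  then show ?thesis using e p q by (simp add: m_assoc)
qed

text \<open>The hypothesis \<open>(e p e q)\<^sup>3 = 1\<close>, which is \<open>(a\<^sub>1 a\<^sub>i)\<^sup>3 = 1\<close>, is the braid relation between \<open>e p e\<close>
  and \<open>q\<close>. Conjugation by \<open>e\<close> makes it one between \<open>p\<close> and \<open>e q e = z q z\<close>, and conjugation by \<open>z\<close>,
  which fixes \<open>p\<close>, one between \<open>p\<close> and \<open>q\<close>.\<close>

lemma half_turn_braid:
  assumes e: "e \<in> carrier G" "e \<otimes> e = \<one>" and p: "p \<in> carrier G" "p \<otimes> p = \<one>"
    and q: "q \<in> carrier G" "q \<otimes> q = \<one>"
    and z: "z = e \<otimes> (p \<otimes> (e \<otimes> p))" "z \<otimes> z = \<one>"
    and conj: "z \<otimes> (q \<otimes> z) = e \<otimes> (q \<otimes> e)"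
    and sixth: "e \<otimes> (p \<otimes> (e \<otimes> (q \<otimes> (e \<otimes> (p \<otimes> (e \<otimes> (q \<otimes> (e \<otimes> (p \<otimes> (e \<otimes> q)))))))))) = \<one>"
  shows "p \<otimes> (q \<otimes> p) = q \<otimes> (p \<otimes> q)"
proof -
  have zc: "z \<in> carrier G" using e p z(1) by simp
  note cancel = square_cancel[OF p(1) _ p(2)] square_cancel[OF e(1) _ e(2)]
    square_cancel[OF zc _ z(2)] square_cancel[OF q(1) _ q(2)]
  define P Q where "P = e \<otimes> (p \<otimes> e)" and "Q = z \<otimes> (q \<otimes> z)"
  have c: "P \<in> carrier G" "Q \<in> carrier G" using e p q zc by (simp_all add: P_def Q_def)
  have PP: "P \<otimes> P = \<one>" using e p by (simp add: P_def m_assoc cancel)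
  have 1: "(P \<otimes> (q \<otimes> P)) \<otimes> (q \<otimes> (P \<otimes> q)) = \<one>"
    using sixth e p q by (simp add: P_def m_assoc)
  have 2: "(P \<otimes> (q \<otimes> P)) \<otimes> (P \<otimes> (q \<otimes> P)) = \<one>"
    using c(1) q by (simp add: m_assoc square_cancel[OF c(1) _ PP] cancel PP)
  have "q \<otimes> (P \<otimes> q) = P \<otimes> (q \<otimes> P)"
    by (rule inverse_unique[OF _ _ _ 1 2]) (simp_all add: c q)
  then have "e \<otimes> (q \<otimes> (P \<otimes> q)) \<otimes> e = e \<otimes> (P \<otimes> (q \<otimes> P)) \<otimes> e" by simp
  then have "Q \<otimes> (p \<otimes> Q) = p \<otimes> (Q \<otimes> p)"
    unfolding Q_def conj P_def using e p q by (simp add: m_assoc cancel)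
  then have zQ: "z \<otimes> (Q \<otimes> (p \<otimes> Q)) \<otimes> z = z \<otimes> (p \<otimes> (Q \<otimes> p)) \<otimes> z" by (simp only:)
  have zp: "z \<otimes> (p \<otimes> z) = p"
    using half_turn_central(2)[OF e p z] zc p z(2) by (metis square_cancel)
  have zpx: "z \<otimes> (p \<otimes> (z \<otimes> x)) = p \<otimes> x" if "x \<in> carrier G" for x
    using that zc p zp by (metis m_assoc m_closed)
  have "p \<otimes> (q \<otimes> p) = z \<otimes> (p \<otimes> (Q \<otimes> p)) \<otimes> z"
    using p q zc by (simp add: Q_def m_assoc zpx zp)
  also note zQ[symmetric]
  also have "z \<otimes> (Q \<otimes> (p \<otimes> Q)) \<otimes> z = q \<otimes> (p \<otimes> q)"
    using p q zc z(2) by (simp add: Q_def m_assoc cancel zpx)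
  finally show ?thesis .
qed

text \<open>The first seven letters of \<open>a\<^sub>1 a\<^sub>i a\<^sub>1 a\<^sub>j\<close> form \<open>e p e q e p e = z (p q p) z\<close>, so the hypothesis
  says that \<open>p q p\<close> commutes with \<open>z r z = e r e\<close>. As \<open>p q p\<close> commutes with \<open>e\<close>, it also
  commutes with \<open>r\<close>.\<close>

lemma half_turn_commute_pair:
  assumes e: "e \<in> carrier G" "e \<otimes> e = \<one>" and p: "p \<in> carrier G" "p \<otimes> p = \<one>"
    and q: "q \<in> carrier G" "q \<otimes> q = \<one>" and r: "r \<in> carrier G" "r \<otimes> r = \<one>"
    and z: "z = e \<otimes> (p \<otimes> (e \<otimes> p))" "z \<otimes> z = \<one>"
    and conj: "z \<otimes> (q \<otimes> z) = e \<otimes> (q \<otimes> e)" "z \<otimes> (r \<otimes> z) = e \<otimes> (r \<otimes> e)"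
    and comm: "e \<otimes> (p \<otimes> (q \<otimes> p)) = (p \<otimes> (q \<otimes> p)) \<otimes> e"
    and eighth: "e \<otimes> (p \<otimes> (e \<otimes> (q \<otimes> (e \<otimes> (p \<otimes> (e \<otimes> (r \<otimes>
        (e \<otimes> (p \<otimes> (e \<otimes> (q \<otimes> (e \<otimes> (p \<otimes> (e \<otimes> r)))))))))))))) = \<one>"
  shows "(p \<otimes> (q \<otimes> p)) \<otimes> r = r \<otimes> (p \<otimes> (q \<otimes> p))"
proof -
  have zc: "z \<in> carrier G" using e p z(1) by simp
  note cancel = square_cancel[OF p(1) _ p(2)] square_cancel[OF e(1) _ e(2)]
    square_cancel[OF zc _ z(2)] square_cancel[OF q(1) _ q(2)] square_cancel[OF r(1) _ r(2)]
  define w where "w = p \<otimes> (q \<otimes> p)"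
  have w: "w \<in> carrier G" "w \<otimes> w = \<one>" using p q by (simp_all add: w_def m_assoc cancel)
  have P: "e \<otimes> (p \<otimes> e) = p \<otimes> z" "e \<otimes> (p \<otimes> e) = z \<otimes> p"
    using half_turn_alt[OF e p z] half_turn_central(2)[OF e p z] e p zc by (simp_all add: cancel)
  have "e \<otimes> (p \<otimes> (e \<otimes> (q \<otimes> (e \<otimes> (p \<otimes> e))))) = (e \<otimes> (p \<otimes> e)) \<otimes> (q \<otimes> (e \<otimes> (p \<otimes> e)))"
    using e p q by (simp add: m_assoc)
  also have "\<dots> = (z \<otimes> p) \<otimes> (q \<otimes> (p \<otimes> z))" by (subst P(2)) (simp only: P(1))
  also have "\<dots> = z \<otimes> (w \<otimes> z)" using p q zc by (simp add: w_def m_assoc)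
  finally have W: "e \<otimes> (p \<otimes> (e \<otimes> (q \<otimes> (e \<otimes> (p \<otimes> e))))) = z \<otimes> (w \<otimes> z)" .
  have "(e \<otimes> (p \<otimes> (e \<otimes> (q \<otimes> (e \<otimes> (p \<otimes> e)))))) \<otimes> (r \<otimes>
      ((e \<otimes> (p \<otimes> (e \<otimes> (q \<otimes> (e \<otimes> (p \<otimes> e)))))) \<otimes> r)) = \<one>"
    using eighth e p q r by (simp add: m_assoc)
  then have "(z \<otimes> (w \<otimes> z)) \<otimes> (r \<otimes> ((z \<otimes> (w \<otimes> z)) \<otimes> r)) = \<one>" by (simp only: W)
  then have "w \<otimes> (z \<otimes> (z \<otimes> (w \<otimes> z) \<otimes> (r \<otimes> (z \<otimes> (w \<otimes> z) \<otimes> r))) \<otimes> z) = w"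
    using w zc z(2) by simp
  then have "(z \<otimes> (r \<otimes> z)) \<otimes> (w \<otimes> (z \<otimes> (r \<otimes> z))) = w"
    using w zc r by (simp add: m_assoc cancel square_cancel[OF w(1) _ w(2)])
  then have "e \<otimes> ((e \<otimes> (r \<otimes> e)) \<otimes> (w \<otimes> (e \<otimes> (r \<otimes> e)))) \<otimes> e = e \<otimes> w \<otimes> e"
    by (simp only: conj)
  then have "r \<otimes> ((e \<otimes> w \<otimes> e) \<otimes> r) = e \<otimes> w \<otimes> e"
    using w e r by (simp add: m_assoc cancel)
  moreover have "e \<otimes> w \<otimes> e = w \<otimes> e \<otimes> e" unfolding w_def using comm by simp
  then have "e \<otimes> w \<otimes> e = w" using w(1) e by (simp add: m_assoc)
  ultimately have rw: "r \<otimes> (r \<otimes> (w \<otimes> r)) = r \<otimes> w" by simp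
  have "w \<otimes> r = r \<otimes> (r \<otimes> (w \<otimes> r))" using w(1) r by (simp add: cancel)
  also note rw
  finally show ?thesis unfolding w_def .
qed

end

section \<open>From star transpositions to Coxeter generators\<close>

text \<open>The elements \<open>t i\<close> play the role of the transpositions \<open>(1, i + 1)\<close> and \<open>\<theta>\<close> that of \<open>\<gamma>\<^sup>(\<^sup>1\<^sup>)\<close>. Braid
  and commutation relations are assumed only where they involve \<open>t 1\<close>; the general ones follow by
  conjugation, since \<open>t 1 \<otimes> t i \<otimes> t 1\<close> plays the role of \<open>(2, i + 1)\<close>.\<close>

locale star_relations = group +
  fixes n :: nat and \<theta> :: 'a and t :: "nat \<Rightarrow> 'a"
  assumes theta_closed: "\<theta> \<in> carrier G"
    and theta_square: "\<theta> \<otimes> \<theta> = \<one>"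
    and t_closed: "1 \<le> i \<Longrightarrow> i < n \<Longrightarrow> t i \<in> carrier G"
    and t_square: "1 \<le> i \<Longrightarrow> i < n \<Longrightarrow> t i \<otimes> t i = \<one>"
    and t_quad: "1 < n \<Longrightarrow> \<theta> \<otimes> (t 1 \<otimes> (\<theta> \<otimes> t 1)) = t 1 \<otimes> (\<theta> \<otimes> (t 1 \<otimes> \<theta>))"
    and t_braid_1: "2 \<le> i \<Longrightarrow> i < n \<Longrightarrow> t 1 \<otimes> (t i \<otimes> t 1) = t i \<otimes> (t 1 \<otimes> t i)"
    and t_commute_1: "2 \<le> i \<Longrightarrow> i < n \<Longrightarrow> 2 \<le> j \<Longrightarrow> j < n \<Longrightarrow> i \<noteq> j
      \<Longrightarrow> (t 1 \<otimes> (t i \<otimes> t 1)) \<otimes> t j = t j \<otimes> (t 1 \<otimes> (t i \<otimes> t 1))"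
    and t_theta_1: "2 \<le> i \<Longrightarrow> i < n
      \<Longrightarrow> (t 1 \<otimes> (t i \<otimes> t 1)) \<otimes> \<theta> = \<theta> \<otimes> (t 1 \<otimes> (t i \<otimes> t 1))"
begin

lemma t_cancel: "1 \<le> i \<Longrightarrow> i < n \<Longrightarrow> x \<in> carrier G \<Longrightarrow> t i \<otimes> (t i \<otimes> x) = x"
  by (simp add: square_cancel t_closed t_square)

lemma t_commute_base:
  assumes "2 \<le> i" "i < n" "2 \<le> j" "j < n" "i \<noteq> j"
  shows "(t i \<otimes> (t j \<otimes> t i)) \<otimes> t 1 = t 1 \<otimes> (t i \<otimes> (t j \<otimes> t i))"
proof -
  have c: "t 1 \<in> carrier G" "t i \<in> carrier G" "t j \<in> carrier G" using assms by (auto intro: t_closed)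
  have "t i \<otimes> (t 1 \<otimes> (t i \<otimes> t j)) = t j \<otimes> (t i \<otimes> (t 1 \<otimes> t i))"
    using t_commute_1[OF assms] t_braid_1[of i] assms c by (simp add: m_assoc)
  then have conj: "t i \<otimes> (t i \<otimes> (t 1 \<otimes> (t i \<otimes> t j)) \<otimes> t i)
      = t i \<otimes> (t j \<otimes> (t i \<otimes> (t 1 \<otimes> t i)) \<otimes> t i)" by (simp only:)
  have "(t i \<otimes> (t j \<otimes> t i)) \<otimes> t 1 = t i \<otimes> (t j \<otimes> (t i \<otimes> (t 1 \<otimes> t i)) \<otimes> t i)"
    using c assms by (simp add: m_assoc t_square)
  also note conj[symmetric]
  also have "t i \<otimes> (t i \<otimes> (t 1 \<otimes> (t i \<otimes> t j)) \<otimes> t i) = t 1 \<otimes> (t i \<otimes> (t j \<otimes> t i))"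
    using c assms by (simp add: m_assoc t_cancel)
  finally show ?thesis .
qed

text \<open>For \<open>i, j \<ge> 2\<close> let \<open>w = t\<^sub>i t\<^sub>j t\<^sub>i\<close>. Writing \<open>w\<close> as \<open>t\<^sub>1 w t\<^sub>1\<close> and the braid relation as
  \<open>t\<^sub>i = t\<^sub>1 t\<^sub>i t\<^sub>1 t\<^sub>i t\<^sub>1\<close> transforms \<open>w t\<^sub>i w\<close> into the conjugate of \<open>t\<^sub>j\<close> by \<open>t\<^sub>1 t\<^sub>i t\<^sub>1\<close>, which is \<open>t\<^sub>j\<close>.
  Hence \<open>t\<^sub>i t\<^sub>j t\<^sub>i t\<^sub>j t\<^sub>i = t\<^sub>j\<close>.\<close>

lemma t_braid:
  assumes "1 \<le> i" "i < n" "1 \<le> j" "j < n" "i \<noteq> j"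
  shows "t i \<otimes> (t j \<otimes> t i) = t j \<otimes> (t i \<otimes> t j)"
proof -
  consider "i = 1" "2 \<le> j" | "j = 1" "2 \<le> i" | "2 \<le> i" "2 \<le> j" using assms by linarith
  then show ?thesis
  proof cases
    case 1 then show ?thesis using t_braid_1[of j] assms by simp
  next
    case 2 then show ?thesis using t_braid_1[of i] assms by simp
  next
    case 3
    have c: "t 1 \<in> carrier G" "t i \<in> carrier G" "t j \<in> carrier G" using assms by (auto intro: t_closed)
    let ?u = "t 1 \<otimes> (t i \<otimes> t 1)" and ?w = "t i \<otimes> (t j \<otimes> t i)"
    have cu: "?u \<in> carrier G" "?w \<in> carrier G" using c by simp_all
    have uu: "?u \<otimes> ?u = \<one>" using c assms 3 by (simp add: m_assoc t_cancel t_square)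
    have tw: "t 1 \<otimes> (?w \<otimes> t 1) = ?w"
      using t_commute_base[of i j] assms 3 c cu by (simp add: t_cancel)
    have ti: "t i = t 1 \<otimes> (t i \<otimes> (t 1 \<otimes> (t i \<otimes> t 1)))"
      using t_braid_1[of i] assms 3 c by (simp add: t_cancel)
    have "?w \<otimes> (t i \<otimes> ?w) = (t 1 \<otimes> (?w \<otimes> t 1)) \<otimes>
        ((t 1 \<otimes> (t i \<otimes> (t 1 \<otimes> (t i \<otimes> t 1)))) \<otimes> (t 1 \<otimes> (?w \<otimes> t 1)))"
      using tw ti by simp
    also have "\<dots> = t 1 \<otimes> (t i \<otimes> ((t j \<otimes> (t 1 \<otimes> t j)) \<otimes> (t i \<otimes> t 1)))"
      using c assms 3 by (simp add: m_assoc t_cancel)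
    also have "t j \<otimes> (t 1 \<otimes> t j) = t 1 \<otimes> (t j \<otimes> t 1)"
      using t_braid_1[of j] assms 3 by simp
    also have "t 1 \<otimes> (t i \<otimes> ((t 1 \<otimes> (t j \<otimes> t 1)) \<otimes> (t i \<otimes> t 1))) = ?u \<otimes> t j \<otimes> ?u"
      using c by (simp add: m_assoc)
    also have "\<dots> = t j"
    proof -
      have "?u \<otimes> t j = t j \<otimes> ?u" using t_commute_1[of i j] assms 3 by blast
      then have "?u \<otimes> t j \<otimes> ?u = t j \<otimes> (?u \<otimes> ?u)" using c by (simp add: m_assoc)
      then show ?thesis using uu c by (simp only: r_one)
    qed
    finally have "?w \<otimes> (t i \<otimes> ?w) = t j" .
    then have "t i \<otimes> (t j \<otimes> (t i \<otimes> (t j \<otimes> t i))) = t j"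
      using c assms 3 by (simp add: m_assoc t_cancel)
    then have w5: "t j \<otimes> (t i \<otimes> (t i \<otimes> (t j \<otimes> (t i \<otimes> (t j \<otimes> t i))))) = t j \<otimes> (t i \<otimes> t j)"
      by (simp only:)
    have "t i \<otimes> (t j \<otimes> t i) = t j \<otimes> (t i \<otimes> (t i \<otimes> (t j \<otimes> (t i \<otimes> (t j \<otimes> t i)))))"
      using c assms by (simp add: t_cancel)
    also note w5
    finally show ?thesis .
  qed
qed

text \<open>In permutations: \<open>(i + 1, j + 1)\<close> is \<open>(2, j + 1)\<close> conjugated by \<open>(2, i + 1)\<close>. Thus an element that
  commutes with \<open>(2, i + 1)\<close> and \<open>(2, j + 1)\<close> also commutes with \<open>(i + 1, j + 1)\<close>, which settles the general case
  of the next two lemmas.\<close>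

lemma t_conj_1:
  assumes "2 \<le> i" "i < n" "2 \<le> j" "j < n" "i \<noteq> j"
  defines "u \<equiv> \<lambda>i. t 1 \<otimes> (t i \<otimes> t 1)"
  shows "t i \<otimes> (t j \<otimes> t i) = u i \<otimes> (u j \<otimes> u i)"
proof -
  have c: "t 1 \<in> carrier G" "t i \<in> carrier G" "t j \<in> carrier G" using assms by (auto intro: t_closed)
  have "u i \<otimes> (u j \<otimes> u i) = t 1 \<otimes> ((t i \<otimes> (t j \<otimes> t i)) \<otimes> t 1)"
    using c assms(1-5) by (simp add: u_def m_assoc t_cancel)
  also have "\<dots> = t i \<otimes> (t j \<otimes> t i)"
    unfolding t_commute_base[OF assms(1-5)] using c assms(1-5) by (simp add: t_cancel)
  finally show ?thesis by simp
qed

lemma t_commute: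
  assumes "1 \<le> i" "i < n" "1 \<le> j" "j < n" "1 \<le> k" "k < n" "i \<noteq> j" "i \<noteq> k" "j \<noteq> k"
  shows "(t i \<otimes> (t j \<otimes> t i)) \<otimes> t k = t k \<otimes> (t i \<otimes> (t j \<otimes> t i))"
proof -
  have "m = 1 \<or> 2 \<le> m" if "1 \<le> m" for m :: nat using that by linarith
  then consider "i = 1" | "j = 1" | "k = 1" | "2 \<le> i" "2 \<le> j" "2 \<le> k" using assms(1,3,5) by blast
  then show ?thesis
  proof cases
    case 1
    show ?thesis unfolding 1 by (rule t_commute_1) (use 1 assms in auto)
  next
    case 2
    show ?thesis unfolding t_braid[OF assms(1-4,7)] unfolding 2
      by (rule t_commute_1) (use 2 assms in auto)
  next
    case 3
    show ?thesis unfolding 3 by (rule t_commute_base) (use 3 assms in auto)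
  next
    case 4
    have c: "t 1 \<in> carrier G" "t i \<in> carrier G" "t j \<in> carrier G" "t k \<in> carrier G"
      using assms by (auto intro: t_closed)
    have ik: "(t 1 \<otimes> (t i \<otimes> t 1)) \<otimes> t k = t k \<otimes> (t 1 \<otimes> (t i \<otimes> t 1))"
      by (rule t_commute_1) (use 4 assms in auto)
    have jk: "(t 1 \<otimes> (t j \<otimes> t 1)) \<otimes> t k = t k \<otimes> (t 1 \<otimes> (t j \<otimes> t 1))"
      by (rule t_commute_1) (use 4 assms in auto)
    show ?thesis unfolding t_conj_1[OF 4(1) assms(2) 4(2) assms(4) assms(7)]
      by (rule commute_mult[OF _ _ _ ik commute_mult[OF _ _ _ jk ik]]) (intro m_closed c)+
  qed
qed

lemma t_theta:
  assumes "1 \<le> i" "i < n" "1 \<le> j" "j < n" "i \<noteq> j"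
  shows "(t i \<otimes> (t j \<otimes> t i)) \<otimes> \<theta> = \<theta> \<otimes> (t i \<otimes> (t j \<otimes> t i))"
proof -
  consider "i = 1" | "j = 1" | "2 \<le> i" "2 \<le> j" using assms by linarith
  then show ?thesis
  proof cases
    case 1
    show ?thesis unfolding 1 by (rule t_theta_1) (use 1 assms in auto)
  next
    case 2
    show ?thesis unfolding t_braid[OF assms] unfolding 2 by (rule t_theta_1) (use 2 assms in auto)
  next
    case 3
    have c: "t 1 \<in> carrier G" "t i \<in> carrier G" "t j \<in> carrier G"
      using assms by (auto intro: t_closed)
    have i: "(t 1 \<otimes> (t i \<otimes> t 1)) \<otimes> \<theta> = \<theta> \<otimes> (t 1 \<otimes> (t i \<otimes> t 1))"
      by (rule t_theta_1) (use 3 assms in auto)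
    have j: "(t 1 \<otimes> (t j \<otimes> t 1)) \<otimes> \<theta> = \<theta> \<otimes> (t 1 \<otimes> (t j \<otimes> t 1))"
      by (rule t_theta_1) (use 3 assms in auto)
    show ?thesis unfolding t_conj_1[OF 3(1) assms(2) 3(2) assms(4) assms(5)]
      by (rule commute_mult[OF _ _ _ i commute_mult[OF _ _ _ j i]]) (intro m_closed c theta_closed)+
  qed
qed

definition coxeter_gen :: "nat \<Rightarrow> 'a"
  where "coxeter_gen i = (if i = 0 then \<theta> else if i = 1 then t 1 else t (i - 1) \<otimes> (t i \<otimes> t (i - 1)))"

text \<open>For \<open>i \<ge> 2\<close> the Coxeter generator is \<open>p q p = q p q\<close> and its successor is \<open>q r q\<close>, where \<open>p, q, r\<close>
  are three consecutive star transpositions; their braid relation is that of \<open>p\<close> and \<open>r\<close>,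
  conjugated by \<open>q\<close>.\<close>

lemma coxeter_gen_type_B: "type_B_relations G n coxeter_gen"
proof
  fix i assume i: "i < n"
  consider "i = 0" | "i = 1" | "2 \<le> i" by linarith
  then have "coxeter_gen i \<in> carrier G \<and> coxeter_gen i \<otimes> coxeter_gen i = \<one>"
  proof cases
    case 3
    then show ?thesis using i t_closed[of i] t_closed[of "i - 1"]
      by (simp add: coxeter_gen_def m_assoc t_cancel t_square)
  qed (use i in \<open>auto simp: coxeter_gen_def theta_closed theta_square t_closed t_square\<close>)
  then show "coxeter_gen i \<in> carrier G" "coxeter_gen i \<otimes> coxeter_gen i = \<one>" by auto
next
  assume "1 < n"
  then show "coxeter_gen 0 \<otimes> (coxeter_gen 1 \<otimes> (coxeter_gen 0 \<otimes> coxeter_gen 1)) =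
      coxeter_gen 1 \<otimes> (coxeter_gen 0 \<otimes> (coxeter_gen 1 \<otimes> coxeter_gen 0))"
    using t_quad by (simp add: coxeter_gen_def)
next
  fix i :: nat assume i: "1 \<le> i" "i + 1 < n"
  show "coxeter_gen i \<otimes> (coxeter_gen (i + 1) \<otimes> coxeter_gen i)
      = coxeter_gen (i + 1) \<otimes> (coxeter_gen i \<otimes> coxeter_gen (i + 1))"
  proof (cases "i = 1")
    case True
    have c: "t 1 \<in> carrier G" "t 2 \<in> carrier G" using i True by (auto intro: t_closed)
    have "t 1 \<otimes> (t 2 \<otimes> (t 1 \<otimes> (t 2 \<otimes> t 1))) = t 1 \<otimes> ((t 2 \<otimes> (t 1 \<otimes> t 2)) \<otimes> t 1)"
      using c by (simp add: m_assoc)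
    also have "\<dots> = t 2"
      using t_braid[of 2 1] i True c by (simp add: m_assoc t_cancel t_square)
    finally show ?thesis using True i c
      by (simp add: coxeter_gen_def m_assoc t_cancel t_square numeral_2_eq_2)
  next
    case False
    define p q r where "p = t (i - 1)" and "q = t i" and "r = t (i + 1)"
    have c: "p \<in> carrier G" "q \<in> carrier G" "r \<in> carrier G"
      using i False by (auto simp: p_def q_def r_def intro: t_closed)
    have qq: "q \<otimes> (q \<otimes> x) = x" if "x \<in> carrier G" for x
      using i that by (simp add: q_def t_cancel)
    have "coxeter_gen i = p \<otimes> (q \<otimes> p)"
      using i False by (simp add: p_def q_def coxeter_gen_def)
    moreover have "p \<otimes> (q \<otimes> p) = q \<otimes> (p \<otimes> q)"
      using t_braid[of "i - 1" i] i False by (auto simp: p_def q_def)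
    ultimately have S: "coxeter_gen i = q \<otimes> (p \<otimes> q)" by simp
    have S': "coxeter_gen (i + 1) = q \<otimes> (r \<otimes> q)"
      using i by (simp add: q_def r_def coxeter_gen_def)
    have "p \<otimes> (r \<otimes> p) = r \<otimes> (p \<otimes> r)"
      using t_braid[of "i - 1" "i + 1"] i False by (auto simp: p_def r_def)
    then have "q \<otimes> ((p \<otimes> (r \<otimes> p)) \<otimes> q) = q \<otimes> ((r \<otimes> (p \<otimes> r)) \<otimes> q)" by simp
    then show ?thesis unfolding S S' using c by (simp add: m_assoc qq)
  qed
next
  fix i j :: nat assume ij: "i + 1 < j" "j < n"
  have c: "t k \<in> carrier G" if "k \<in> {1..<n}" for k using that by (auto intro: t_closed)
  define w where "w = t (j - 1) \<otimes> (t j \<otimes> t (j - 1))"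
  have Sj: "coxeter_gen j = w" using ij by (simp add: coxeter_gen_def w_def)
  have wc: "w \<in> carrier G" using ij by (auto simp: w_def intro!: t_closed m_closed)
  have comm: "t k \<otimes> w = w \<otimes> t k" if "1 \<le> k" "k + 1 < j" for k
    unfolding w_def using ij that by (intro t_commute[symmetric]) auto
  consider "i = 0" | "i = 1" | "2 \<le> i" by linarith
  then show "coxeter_gen i \<otimes> coxeter_gen j = coxeter_gen j \<otimes> coxeter_gen i"
  proof cases
    case 1
    have "\<theta> \<otimes> w = w \<otimes> \<theta>"
      unfolding w_def using ij by (intro t_theta[symmetric]) auto
    then show ?thesis using 1 by (simp add: Sj) (simp add: coxeter_gen_def)
  next
    case 2
    then show ?thesis using comm[of 1] ij by (simp add: Sj) (simp add: coxeter_gen_def)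
  next
    case 3
    then have Si: "coxeter_gen i = t (i - 1) \<otimes> (t i \<otimes> t (i - 1))" by (simp add: coxeter_gen_def)
    have "1 \<le> i - 1" "i - 1 + 1 < j" "1 \<le> i" "i < n" "i - 1 < n" using 3 ij by auto
    then have "t (i - 1) \<in> carrier G" "t i \<in> carrier G" "t (i - 1) \<otimes> w = w \<otimes> t (i - 1)"
      "t i \<otimes> w = w \<otimes> t i"
      using comm ij c by auto
    then show ?thesis unfolding Sj Si by (intro commute_mult m_closed wc)
  qed
qed

end

section \<open>The relations between the generators of the alternating group\<close>

locale alt_B_relations = group +
  fixes n :: nat and a :: "nat \<Rightarrow> 'a"
  assumes a_closed: "1 \<le> i \<Longrightarrow> i < n \<Longrightarrow> a i \<in> carrier G"
    and a_fourth: "1 \<le> i \<Longrightarrow> i < n \<Longrightarrow> a i \<otimes> (a i \<otimes> (a i \<otimes> a i)) = \<one>"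
    and a_sixth: "2 \<le> i \<Longrightarrow> i < n
      \<Longrightarrow> a 1 \<otimes> (a i \<otimes> (a 1 \<otimes> (a i \<otimes> (a 1 \<otimes> a i)))) = \<one>"
    and a_square: "2 \<le> i \<Longrightarrow> i < n
      \<Longrightarrow> a 1 \<otimes> (a 1 \<otimes> (a i \<otimes> (a 1 \<otimes> (a 1 \<otimes> a i)))) = \<one>"
    and a_eighth: "2 \<le> i \<Longrightarrow> i < j \<Longrightarrow> j < n
      \<Longrightarrow> a 1 \<otimes> (a i \<otimes> (a 1 \<otimes> (a j \<otimes> (a 1 \<otimes> (a i \<otimes> (a 1 \<otimes> a j)))))) = \<one>"
begin

text \<open>Inverting a relator reverses it, and the reversed relators are cyclic permutations of the original
  ones with \<open>a\<^sub>i\<close> replaced by \<open>a\<^sub>i\<^sup>-\<^sup>1\<close>.\<close>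

lemma inverse_relations: "alt_B_relations G n (\<lambda>i. inv\<^bsub>G\<^esub> (a i))"
proof -
  have rot: "y \<otimes> x = \<one>" if "x \<otimes> y = \<one>" "x \<in> carrier G" "y \<in> carrier G" for x y
    using that by (metis inv_equality r_inv)
  have I: "inv\<^bsub>G\<^esub> x = \<one>" if "x = \<one>" for x using that by simp
  show ?thesis
  proof
    fix i assume i: "1 \<le> i" "i < n"
    then show "inv\<^bsub>G\<^esub> (a i) \<in> carrier G" by (simp add: a_closed)
    show "inv\<^bsub>G\<^esub> (a i) \<otimes> (inv\<^bsub>G\<^esub> (a i) \<otimes> (inv\<^bsub>G\<^esub> (a i) \<otimes> inv\<^bsub>G\<^esub> (a i))) = \<one>"
      using I[OF a_fourth[OF i]] a_closed[OF i] by (simp add: inv_mult_group m_assoc)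
  next
    fix i assume i: "2 \<le> i" "i < n"
    have c: "a 1 \<in> carrier G" "a i \<in> carrier G" using i by (auto intro: a_closed)
    have "inv\<^bsub>G\<^esub> (a i) \<otimes> (inv\<^bsub>G\<^esub> (a 1) \<otimes> (inv\<^bsub>G\<^esub> (a i) \<otimes> (inv\<^bsub>G\<^esub> (a 1) \<otimes> (inv\<^bsub>G\<^esub> (a i) \<otimes> inv\<^bsub>G\<^esub> (a 1))))) = \<one>"
      using I[OF a_sixth[OF i]] c by (simp add: inv_mult_group m_assoc)
    from rot[OF this] show "inv\<^bsub>G\<^esub> (a 1) \<otimes> (inv\<^bsub>G\<^esub> (a i) \<otimes> (inv\<^bsub>G\<^esub> (a 1) \<otimes> (inv\<^bsub>G\<^esub> (a i) \<otimes> (inv\<^bsub>G\<^esub> (a 1) \<otimes> inv\<^bsub>G\<^esub> (a i))))) = \<one>"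
      using c by (simp add: m_assoc)
    have "inv\<^bsub>G\<^esub> (a i) \<otimes> (inv\<^bsub>G\<^esub> (a 1) \<otimes> (inv\<^bsub>G\<^esub> (a 1) \<otimes> (inv\<^bsub>G\<^esub> (a i) \<otimes> (inv\<^bsub>G\<^esub> (a 1) \<otimes> inv\<^bsub>G\<^esub> (a 1))))) = \<one>"
      using I[OF a_square[OF i]] c by (simp add: inv_mult_group m_assoc)
    from rot[OF this] show "inv\<^bsub>G\<^esub> (a 1) \<otimes> (inv\<^bsub>G\<^esub> (a 1) \<otimes> (inv\<^bsub>G\<^esub> (a i) \<otimes> (inv\<^bsub>G\<^esub> (a 1) \<otimes> (inv\<^bsub>G\<^esub> (a 1) \<otimes> inv\<^bsub>G\<^esub> (a i))))) = \<one>"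
      using c by (simp add: m_assoc)
  next
    fix i j assume ij: "2 \<le> i" "i < j" "j < n"
    have c: "a 1 \<in> carrier G" "a i \<in> carrier G" "a j \<in> carrier G" using ij by (auto intro: a_closed)
    have "inv\<^bsub>G\<^esub> (a j) \<otimes> (inv\<^bsub>G\<^esub> (a 1) \<otimes> (inv\<^bsub>G\<^esub> (a i) \<otimes> (inv\<^bsub>G\<^esub> (a 1) \<otimes> (inv\<^bsub>G\<^esub> (a j) \<otimes> (inv\<^bsub>G\<^esub> (a 1) \<otimes> (inv\<^bsub>G\<^esub> (a i) \<otimes> inv\<^bsub>G\<^esub> (a 1))))))) = \<one>"
      using I[OF a_eighth[OF ij]] c by (simp add: inv_mult_group m_assoc)
    from rot[OF this] show "inv\<^bsub>G\<^esub> (a 1) \<otimes> (inv\<^bsub>G\<^esub> (a i) \<otimes> (inv\<^bsub>G\<^esub> (a 1) \<otimes> (inv\<^bsub>G\<^esub> (a j) \<otimes> (inv\<^bsub>G\<^esub> (a 1) \<otimes> (inv\<^bsub>G\<^esub> (a i) \<otimes> (inv\<^bsub>G\<^esub> (a 1) \<otimes> inv\<^bsub>G\<^esub> (a j))))))) = \<one>"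
      using c by (simp add: m_assoc)
  qed
qed

text \<open>The last hypothesis says that \<open>\<theta>\<close> inverts \<open>a i\<close>, or equivalently that \<open>\<theta> \<otimes> a i\<close> is an involution.\<close>

lemma star_relations_extension:
  assumes th: "\<theta> \<in> carrier G" "\<theta> \<otimes> \<theta> = \<one>"
    and inverts: "\<And>i. 1 \<le> i \<Longrightarrow> i < n \<Longrightarrow> \<theta> \<otimes> (a i \<otimes> (\<theta> \<otimes> a i)) = \<one>"
  shows "star_relations G n \<theta> (\<lambda>i. \<theta> \<otimes> a i)"
proof -
  define t where "t i = \<theta> \<otimes> a i" for i
  have tc: "t i \<in> carrier G" if "1 \<le> i" "i < n" for i
    using that th by (simp add: t_def a_closed)
  have tt: "t i \<otimes> t i = \<one>" if "1 \<le> i" "i < n" for i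
    using that th inverts by (simp add: t_def a_closed m_assoc)
  have a: "a i = \<theta> \<otimes> t i" if "1 \<le> i" "i < n" for i
    using that th by (simp add: t_def a_closed square_cancel)
  define p where "p = t 1"
  define z where "z = \<theta> \<otimes> (p \<otimes> (\<theta> \<otimes> p))"
  have p: "p \<in> carrier G" "p \<otimes> p = \<one>" if "1 < n"
    using that tc[of 1] tt[of 1] by (auto simp: p_def)
  have a1: "a 1 = \<theta> \<otimes> p" if "1 < n" using that a[of 1] by (simp add: p_def)
  have zz: "z \<otimes> z = \<one>" if "1 < n"
    using a_fourth[of 1] a1 p that th by (simp add: z_def m_assoc)
  have R: "\<theta> \<otimes> (p \<otimes> (q \<otimes> p)) = (p \<otimes> (q \<otimes> p)) \<otimes> \<theta>" "p \<otimes> (q \<otimes> p) = q \<otimes> (p \<otimes> q)"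
    "z \<otimes> (q \<otimes> z) = \<theta> \<otimes> (q \<otimes> \<theta>)" if i: "2 \<le> i" "i < n" "q = t i" for i q
  proof -
    have n: "1 < n" using i by simp
    have q: "q \<in> carrier G" "q \<otimes> q = \<one>" using i tc tt by auto
    have "z \<otimes> (\<theta> \<otimes> (q \<otimes> (z \<otimes> (\<theta> \<otimes> q)))) = \<one>"
      using a_square[OF i(1,2)] a[of i] i th p[OF n] q a1[OF n] by (simp add: z_def m_assoc)
    then show c: "z \<otimes> (q \<otimes> z) = \<theta> \<otimes> (q \<otimes> \<theta>)"
      using half_turn_conj[OF th p[OF n] q z_def zz[OF n]] by simp
    show "\<theta> \<otimes> (p \<otimes> (q \<otimes> p)) = (p \<otimes> (q \<otimes> p)) \<otimes> \<theta>"
      by (rule half_turn_commute[OF th p[OF n] q z_def zz[OF n] c])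
    have "\<theta> \<otimes> (p \<otimes> (\<theta> \<otimes> (q \<otimes> (\<theta> \<otimes> (p \<otimes> (\<theta> \<otimes> (q \<otimes> (\<theta> \<otimes> (p \<otimes> (\<theta> \<otimes> q)))))))))) = \<one>"
      using a_sixth[OF i(1,2)] a[of i] i th p[OF n] q a1[OF n] by (simp add: m_assoc)
    then show "p \<otimes> (q \<otimes> p) = q \<otimes> (p \<otimes> q)"
      by (rule half_turn_braid[OF th p[OF n] q z_def zz[OF n] c])
  qed
  have C: "(p \<otimes> (q \<otimes> p)) \<otimes> r = r \<otimes> (p \<otimes> (q \<otimes> p))"
    if ij: "2 \<le> i" "i < j" "j < n" "q = t i" "r = t j" for i j q r
  proof -
    have n: "1 < n" using ij by simp
    have i: "t i \<in> carrier G" "t i \<otimes> t i = \<one>" and j: "t j \<in> carrier G" "t j \<otimes> t j = \<one>"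
      using ij tc tt by auto
    have "\<theta> \<otimes> (p \<otimes> (\<theta> \<otimes> (t i \<otimes> (\<theta> \<otimes> (p \<otimes> (\<theta> \<otimes> (t j \<otimes>
        (\<theta> \<otimes> (p \<otimes> (\<theta> \<otimes> (t i \<otimes> (\<theta> \<otimes> (p \<otimes> (\<theta> \<otimes> t j)))))))))))))) = \<one>"
      using a_eighth[OF ij(1-3)] a[of i] a[of j] a1[OF n] ij th i j p[OF n] by (simp add: m_assoc)
    then show ?thesis
      using ij half_turn_commute_pair[OF th p[OF n] i j z_def zz[OF n] R(3)[of i] R(3)[of j] R(1)[of i]]
      by simp
  qed
  have "star_relations G n \<theta> t"
  proof
    assume "1 < n"
    then show "\<theta> \<otimes> (t 1 \<otimes> (\<theta> \<otimes> t 1)) = t 1 \<otimes> (\<theta> \<otimes> (t 1 \<otimes> \<theta>))"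
      using half_turn_alt[OF th p z_def zz] by (simp add: z_def p_def)
  next
    fix i assume "2 \<le> i" "i < n"
    then show "t 1 \<otimes> (t i \<otimes> t 1) = t i \<otimes> (t 1 \<otimes> t i)"
      "(t 1 \<otimes> (t i \<otimes> t 1)) \<otimes> \<theta> = \<theta> \<otimes> (t 1 \<otimes> (t i \<otimes> t 1))"
      using R(1,2) by (auto simp: p_def)
  next
    fix i j assume "2 \<le> i" "i < n" "2 \<le> j" "j < n" "i \<noteq> j"
    note ij = this
    then have c: "p \<in> carrier G" "p \<otimes> p = \<one>" "t i \<in> carrier G" "t j \<in> carrier G"
      using p tc by auto
    show "(t 1 \<otimes> (t i \<otimes> t 1)) \<otimes> t j = t j \<otimes> (t 1 \<otimes> (t i \<otimes> t 1))"
    proof (cases "i < j")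
      case True
      then show ?thesis using C[of i j] ij by (simp add: p_def)
    next
      case False
      then have "(p \<otimes> (t j \<otimes> p)) \<otimes> t i = t i \<otimes> (p \<otimes> (t j \<otimes> p))" using C[of j i] ij by simp
      then have "p \<otimes> ((p \<otimes> (t j \<otimes> p)) \<otimes> t i) \<otimes> p = p \<otimes> (t i \<otimes> (p \<otimes> (t j \<otimes> p))) \<otimes> p" by simp
      then have "t j \<otimes> (p \<otimes> (t i \<otimes> p)) = (p \<otimes> (t i \<otimes> p)) \<otimes> t j"
        using c by (simp add: m_assoc square_cancel[OF c(1) _ c(2)])
      then show ?thesis by (simp add: p_def)
    qed
  qed (use th tc tt in auto)
  then show ?thesis by (simp add: t_def[abs_def])
qed

end

context star_relations
begin

text \<open>With \<open>q = t i\<close> and \<open>r = t (i + 1)\<close> the recursive step computes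
  \<open>(q r q) q (q r q) = q r q r q = r\<close>.\<close>

lemma star_transp_coxeter_gen:
  "1 \<le> i \<Longrightarrow> i < n \<Longrightarrow> star_transp G coxeter_gen i = t i"
proof (induction i)
  case (Suc i)
  show ?case
  proof (cases "i = 0")
    case True
    then show ?thesis by (simp add: coxeter_gen_def)
  next
    case False
    then have i: "1 \<le> i" "i < n" "t i \<in> carrier G" "t (Suc i) \<in> carrier G"
      using Suc.prems by (auto intro: t_closed)
    have S: "coxeter_gen (Suc i) = t i \<otimes> (t (Suc i) \<otimes> t i)"
      using False by (simp add: coxeter_gen_def)
    have "star_transp G coxeter_gen (Suc i) =
        (t i \<otimes> (t (Suc i) \<otimes> t i)) \<otimes> (t i \<otimes> (t i \<otimes> (t (Suc i) \<otimes> t i)))"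
      using False Suc.IH[OF i(1,2)] S by simp
    also have "\<dots> = (t i \<otimes> (t (Suc i) \<otimes> t i)) \<otimes> (t (Suc i) \<otimes> t i)"
      using i Suc.prems by (simp add: t_cancel)
    also have "t i \<otimes> (t (Suc i) \<otimes> t i) = t (Suc i) \<otimes> (t i \<otimes> t (Suc i))"
      using i Suc.prems by (intro t_braid) auto
    also have "\<dots> \<otimes> (t (Suc i) \<otimes> t i) = t (Suc i)"
      using i Suc.prems by (simp add: m_assoc t_cancel t_square)
    finally show ?thesis .
  qed
qed simp

end

lemma group_alt_B_presented: "group (alt_B_presented n)"
  unfolding alt_B_presented_def by (rule group_presented_group)

lemma alt_B_presented_relations: "alt_B_relations (alt_B_presented n) n (alt_B_gen n)"
proof -
  interpret G: group "alt_B_presented n" by (rule group_alt_B_presented)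
  have c: "alt_B_gen n i \<in> carrier (alt_B_presented n)" if "1 \<le> i" "i < n" for i
    unfolding alt_B_gen_def alt_B_presented_def using that by (intro pres_gen_closed) auto
  have rel: "word_value (alt_B_presented n) (alt_B_gen n) l = word_value (alt_B_presented n) (alt_B_gen n) r"
    if "(l, r) \<in> alt_B_rels n" "l \<in> gwords {1..n - 1}" "r \<in> gwords {1..n - 1}" for l r
    using pres_gen_relation[OF that] unfolding alt_B_presented_def alt_B_gen_def[abs_def] .
  note wp = word_power_def numeral_2_eq_2 numeral_3_eq_3 eval_nat_numeral
  show ?thesis
  proof
    fix i assume i: "1 \<le> i" "i < n"
    then show "alt_B_gen n i \<in> carrier (alt_B_presented n)" by (rule c)
    have "(word_power (letter i) 4, []) \<in> alt_B_rels n"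
      using i by (auto simp: alt_B_rels_def)
    from rel[OF this] show "alt_B_gen n i \<otimes>\<^bsub>alt_B_presented n\<^esub> (alt_B_gen n i \<otimes>\<^bsub>alt_B_presented n\<^esub>
        (alt_B_gen n i \<otimes>\<^bsub>alt_B_presented n\<^esub> alt_B_gen n i)) = \<one>\<^bsub>alt_B_presented n\<^esub>"
      using i by (simp add: wp c)
  next
    fix i assume i: "2 \<le> i" "i < n"
    have c': "alt_B_gen n 1 \<in> carrier (alt_B_presented n)" "alt_B_gen n i \<in> carrier (alt_B_presented n)"
      using i c by auto
    have b: "1 \<le> n - 1" "i \<le> n - 1" using i by auto
    have "(word_power (letter 1 @ letter i) 3, []) \<in> alt_B_rels n"
      unfolding alt_B_rels_def using i by fastforce
    from rel[OF this] show "alt_B_gen n 1 \<otimes>\<^bsub>alt_B_presented n\<^esub> (alt_B_gen n i \<otimes>\<^bsub>alt_B_presented n\<^esub>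
        (alt_B_gen n 1 \<otimes>\<^bsub>alt_B_presented n\<^esub> (alt_B_gen n i \<otimes>\<^bsub>alt_B_presented n\<^esub>
        (alt_B_gen n 1 \<otimes>\<^bsub>alt_B_presented n\<^esub> alt_B_gen n i)))) = \<one>\<^bsub>alt_B_presented n\<^esub>"
      using i b c' by (simp add: wp)
    have "(word_power (word_power (letter 1) 2 @ letter i) 2, []) \<in> alt_B_rels n"
      unfolding alt_B_rels_def using i by fastforce
    from rel[OF this] show "alt_B_gen n 1 \<otimes>\<^bsub>alt_B_presented n\<^esub> (alt_B_gen n 1 \<otimes>\<^bsub>alt_B_presented n\<^esub>
        (alt_B_gen n i \<otimes>\<^bsub>alt_B_presented n\<^esub> (alt_B_gen n 1 \<otimes>\<^bsub>alt_B_presented n\<^esub>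
        (alt_B_gen n 1 \<otimes>\<^bsub>alt_B_presented n\<^esub> alt_B_gen n i)))) = \<one>\<^bsub>alt_B_presented n\<^esub>"
      using i b c' by (simp add: wp)
  next
    fix i j assume ij: "2 \<le> i" "i < j" "j < n"
    have c': "alt_B_gen n 1 \<in> carrier (alt_B_presented n)" "alt_B_gen n i \<in> carrier (alt_B_presented n)"
      "alt_B_gen n j \<in> carrier (alt_B_presented n)"
      using ij c by auto
    have b: "1 \<le> n - 1" "i \<le> n - 1" "j \<le> n - 1" using ij by auto
    then have "(word_power (letter 1 @ letter i @ letter 1 @ letter j) 2, []) \<in> alt_B_rels n"
      unfolding alt_B_rels_def using ij by blast
    from rel[OF this] show "alt_B_gen n 1 \<otimes>\<^bsub>alt_B_presented n\<^esub> (alt_B_gen n i \<otimes>\<^bsub>alt_B_presented n\<^esub>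
        (alt_B_gen n 1 \<otimes>\<^bsub>alt_B_presented n\<^esub> (alt_B_gen n j \<otimes>\<^bsub>alt_B_presented n\<^esub>
        (alt_B_gen n 1 \<otimes>\<^bsub>alt_B_presented n\<^esub> (alt_B_gen n i \<otimes>\<^bsub>alt_B_presented n\<^esub>
        (alt_B_gen n 1 \<otimes>\<^bsub>alt_B_presented n\<^esub> alt_B_gen n j)))))) = \<one>\<^bsub>alt_B_presented n\<^esub>"
      using ij b c' by (simp add: wp)
  qed
qed

context alt_B_relations
begin

lemma word_value_alt_B_rels:
  assumes "(l, r) \<in> alt_B_rels n" shows "word_value G a l = word_value G a r"
proof -
  note wp = word_power_def numeral_2_eq_2 numeral_3_eq_3 eval_nat_numeral
  consider i where "1 \<le> i" "i \<le> n - 1" "l = word_power (letter i) 4" "r = []"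
    | i where "2 \<le> i" "i \<le> n - 1" "l = word_power (letter 1 @ letter i) 3" "r = []"
    | i where "2 \<le> i" "i \<le> n - 1" "l = word_power (word_power (letter 1) 2 @ letter i) 2" "r = []"
    | i j where "2 \<le> i" "i < j" "j \<le> n - 1"
        "l = word_power (letter 1 @ letter i @ letter 1 @ letter j) 2" "r = []"
    using assms unfolding alt_B_rels_def by blast
  then show ?thesis
  proof cases
    case (1 i)
    then show ?thesis using a_fourth[of i] a_closed[of i] by (simp add: wp)
  next
    case (2 i)
    then show ?thesis using a_sixth[of i] a_closed[of i] a_closed[of 1] by (simp add: wp)
  next
    case (3 i)
    then show ?thesis using a_square[of i] a_closed[of i] a_closed[of 1] by (simp add: wp)
  next
    case (4 i j)
    then show ?thesis using a_eighth[of i j] a_closed[of i] a_closed[of j] a_closed[of 1]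
      by (simp add: wp)
  qed
qed

lemma alt_B_lift:
  shows "pres_lift G a \<in> hom (alt_B_presented n) G"
    and "1 \<le> i \<Longrightarrow> i < n \<Longrightarrow> pres_lift G a (alt_B_gen n i) = a i"
proof -
  have f: "a \<in> {1..n - 1} \<rightarrow> carrier G" using a_closed by auto
  note R = word_value_alt_B_rels
  show "pres_lift G a \<in> hom (alt_B_presented n) G"
    unfolding alt_B_presented_def by (rule pres_lift_hom[OF f R])
  show "1 \<le> i \<Longrightarrow> i < n \<Longrightarrow> pres_lift G a (alt_B_gen n i) = a i"
    unfolding alt_B_gen_def by (rule pres_lift_gen[OF f R]) auto
qed

lemma hom_relations:
  assumes "group H" "h \<in> hom G H"
  shows "alt_B_relations H n (\<lambda>i. h (a i))"
proof -
  interpret group_hom G H h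
    using assms by (simp add: group_hom_def group_hom_axioms_def is_group)
  note c = a_closed
  show ?thesis
  proof
    fix i assume i: "1 \<le> i" "i < n"
    then show "h (a i) \<in> carrier H" by (simp add: c)
    show "h (a i) \<otimes>\<^bsub>H\<^esub> (h (a i) \<otimes>\<^bsub>H\<^esub> (h (a i) \<otimes>\<^bsub>H\<^esub> h (a i))) = \<one>\<^bsub>H\<^esub>"
      using arg_cong[OF a_fourth[OF i], of h] c[OF i] by simp
  next
    fix i assume i: "2 \<le> i" "i < n"
    have c': "a 1 \<in> carrier G" "a i \<in> carrier G" using i c by auto
    show "h (a 1) \<otimes>\<^bsub>H\<^esub> (h (a i) \<otimes>\<^bsub>H\<^esub> (h (a 1) \<otimes>\<^bsub>H\<^esub> (h (a i) \<otimes>\<^bsub>H\<^esub> (h (a 1) \<otimes>\<^bsub>H\<^esub> h (a i))))) = \<one>\<^bsub>H\<^esub>"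
      using arg_cong[OF a_sixth[OF i], of h] c' by simp
    show "h (a 1) \<otimes>\<^bsub>H\<^esub> (h (a 1) \<otimes>\<^bsub>H\<^esub> (h (a i) \<otimes>\<^bsub>H\<^esub> (h (a 1) \<otimes>\<^bsub>H\<^esub> (h (a 1) \<otimes>\<^bsub>H\<^esub> h (a i))))) = \<one>\<^bsub>H\<^esub>"
      using arg_cong[OF a_square[OF i], of h] c' by simp
  next
    fix i j assume ij: "2 \<le> i" "i < j" "j < n"
    have c': "a 1 \<in> carrier G" "a i \<in> carrier G" "a j \<in> carrier G" using ij c by auto
    show "h (a 1) \<otimes>\<^bsub>H\<^esub> (h (a i) \<otimes>\<^bsub>H\<^esub> (h (a 1) \<otimes>\<^bsub>H\<^esub> (h (a j) \<otimes>\<^bsub>H\<^esub> (h (a 1) \<otimes>\<^bsub>H\<^esub> (h (a i) \<otimes>\<^bsub>H\<^esub> (h (a 1) \<otimes>\<^bsub>H\<^esub> h (a j))))))) = \<one>\<^bsub>H\<^esub>"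
      using arg_cong[OF a_eighth[OF ij], of h] c' by simp
  qed
qed

end

lemma alt_B_presented_hom_eq:
  assumes "group H" "h \<in> hom (alt_B_presented n) H" "h' \<in> hom (alt_B_presented n) H"
    and "\<And>i. 1 \<le> i \<Longrightarrow> i < n \<Longrightarrow> h (alt_B_gen n i) = h' (alt_B_gen n i)"
    and "x \<in> carrier (alt_B_presented n)"
  shows "h x = h' x"
proof -
  have "h (pres_gen {1..n - 1} (alt_B_rels n) i) = h' (pres_gen {1..n - 1} (alt_B_rels n) i)"
    if "i \<in> {1..n - 1}" for i
    using assms(4)[of i] that by (auto simp: alt_B_gen_def)
  then show ?thesis
    using presented_group_hom_eq[OF assms(1), of h "{1..n - 1}" "alt_B_rels n" h' x] assms(2,3,5)
    by (auto simp: alt_B_presented_def)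
qed

text \<open>Each relation is checked separately in the two components: in \<open>C\<^sub>2\<^sup>n\<close> the factors \<open>\<gamma>\<^sup>(\<^sup>k\<^sup>)\<close> cancel in
  pairs, and in the symmetric group it is an identity between products of transpositions.\<close>

lemma wreath_alt_B_relations:
  "alt_B_relations (wreath_C2 n) n (\<lambda>i. (gamma n 1, Transposition.transpose 1 (i + 1)))"
proof -
  interpret W: group "wreath_C2 n" by (rule group_wreath_C2)
  interpret C: comm_group "C2_pow n"
    by (rule group.group_comm_groupI[OF group_C2_pow]) (simp add: C2_pow_mult add.commute)
  have t: "Transposition.transpose 1 (i + 1) permutes {1..n}" if "1 \<le> i" "i < n" for i
    using that by (intro permutes_swap_id) auto
  have gg: "gamma n i \<otimes>\<^bsub>C2_pow n\<^esub> (gamma n i \<otimes>\<^bsub>C2_pow n\<^esub> g) = g" if "g \<in> carrier (C2_pow n)" for i g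
    using that by (simp add: gamma_closed gamma_square flip: C.m_assoc)
  note ac = C.m_ac gamma_closed gamma_square gg
  show ?thesis
  proof
    fix i assume i: "1 \<le> i" "i < n"
    note t = t[OF i]
    show "(gamma n 1, Transposition.transpose 1 (i + 1)) \<in> carrier (wreath_C2 n)"
      using t by (simp add: wreath_carrier gamma_closed)
    show "(gamma n 1, Transposition.transpose 1 (i + 1)) \<otimes>\<^bsub>wreath_C2 n\<^esub>
      ((gamma n 1, Transposition.transpose 1 (i + 1)) \<otimes>\<^bsub>wreath_C2 n\<^esub>
      ((gamma n 1, Transposition.transpose 1 (i + 1)) \<otimes>\<^bsub>wreath_C2 n\<^esub>
       (gamma n 1, Transposition.transpose 1 (i + 1)))) = \<one>\<^bsub>wreath_C2 n\<^esub>"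
      unfolding wreath_mult wreath_one prod.inject perm_act_mult[OF t] perm_act_gamma[OF t]
      using i by (intro conjI) (simp add: Transposition.transpose_def ac,
        auto simp: fun_eq_iff Transposition.transpose_def)
  next
    fix i assume i: "2 \<le> i" "i < n"
    have tt: "Transposition.transpose 1 (1 + 1) permutes {1..n}" "Transposition.transpose 1 (i + 1) permutes {1..n}"
      using i t by auto
    show "(gamma n 1, Transposition.transpose 1 (1 + 1)) \<otimes>\<^bsub>wreath_C2 n\<^esub>
      ((gamma n 1, Transposition.transpose 1 (i + 1)) \<otimes>\<^bsub>wreath_C2 n\<^esub>
      ((gamma n 1, Transposition.transpose 1 (1 + 1)) \<otimes>\<^bsub>wreath_C2 n\<^esub>
      ((gamma n 1, Transposition.transpose 1 (i + 1)) \<otimes>\<^bsub>wreath_C2 n\<^esub>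
      ((gamma n 1, Transposition.transpose 1 (1 + 1)) \<otimes>\<^bsub>wreath_C2 n\<^esub>
       (gamma n 1, Transposition.transpose 1 (i + 1)))))) = \<one>\<^bsub>wreath_C2 n\<^esub>"
      unfolding wreath_mult wreath_one prod.inject perm_act_mult[OF tt(1)] perm_act_gamma[OF tt(1)]
        perm_act_mult[OF tt(2)] perm_act_gamma[OF tt(2)]
      using i by (intro conjI) (simp add: Transposition.transpose_def ac,
        auto simp: fun_eq_iff Transposition.transpose_def)
    show "(gamma n 1, Transposition.transpose 1 (1 + 1)) \<otimes>\<^bsub>wreath_C2 n\<^esub>
      ((gamma n 1, Transposition.transpose 1 (1 + 1)) \<otimes>\<^bsub>wreath_C2 n\<^esub>
      ((gamma n 1, Transposition.transpose 1 (i + 1)) \<otimes>\<^bsub>wreath_C2 n\<^esub>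
      ((gamma n 1, Transposition.transpose 1 (1 + 1)) \<otimes>\<^bsub>wreath_C2 n\<^esub>
      ((gamma n 1, Transposition.transpose 1 (1 + 1)) \<otimes>\<^bsub>wreath_C2 n\<^esub>
       (gamma n 1, Transposition.transpose 1 (i + 1)))))) = \<one>\<^bsub>wreath_C2 n\<^esub>"
      unfolding wreath_mult wreath_one prod.inject perm_act_mult[OF tt(1)] perm_act_gamma[OF tt(1)] perm_act_mult[OF tt(2)] perm_act_gamma[OF tt(2)]
      using i by (intro conjI) (simp add: Transposition.transpose_def ac,
        auto simp: fun_eq_iff Transposition.transpose_def)
  next
    fix i j assume ij: "2 \<le> i" "i < j" "j < n"
    have tt: "Transposition.transpose 1 (1 + 1) permutes {1..n}"
      "Transposition.transpose 1 (i + 1) permutes {1..n}"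
      "Transposition.transpose 1 (j + 1) permutes {1..n}"
      using ij t by auto
    show "(gamma n 1, Transposition.transpose 1 (1 + 1)) \<otimes>\<^bsub>wreath_C2 n\<^esub>
      ((gamma n 1, Transposition.transpose 1 (i + 1)) \<otimes>\<^bsub>wreath_C2 n\<^esub>
      ((gamma n 1, Transposition.transpose 1 (1 + 1)) \<otimes>\<^bsub>wreath_C2 n\<^esub>
      ((gamma n 1, Transposition.transpose 1 (j + 1)) \<otimes>\<^bsub>wreath_C2 n\<^esub>
      ((gamma n 1, Transposition.transpose 1 (1 + 1)) \<otimes>\<^bsub>wreath_C2 n\<^esub>
      ((gamma n 1, Transposition.transpose 1 (i + 1)) \<otimes>\<^bsub>wreath_C2 n\<^esub>
      ((gamma n 1, Transposition.transpose 1 (1 + 1)) \<otimes>\<^bsub>wreath_C2 n\<^esub>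
       (gamma n 1, Transposition.transpose 1 (j + 1)))))))) = \<one>\<^bsub>wreath_C2 n\<^esub>"
      unfolding wreath_mult wreath_one prod.inject perm_act_mult[OF tt(1)] perm_act_gamma[OF tt(1)] perm_act_mult[OF tt(2)] perm_act_gamma[OF tt(2)] perm_act_mult[OF tt(3)] perm_act_gamma[OF tt(3)]
      using ij by (intro conjI) (simp add: Transposition.transpose_def ac,
        auto simp: fun_eq_iff Transposition.transpose_def)
  qed
qed

section \<open>Extension by an involution\<close>

text \<open>The semidirect product of \<open>G\<close> with a group of order 2 whose generator \<open>(\<one>, True)\<close> acts by \<open>\<theta>\<close>.\<close>

definition involution_extension :: "('a, 'b) monoid_scheme \<Rightarrow> ('a \<Rightarrow> 'a) \<Rightarrow> ('a \<times> bool) monoid"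
  where "involution_extension G \<theta> =
    \<lparr> carrier = carrier G \<times> UNIV,
      mult = (\<lambda>(g, b) (h, c). (g \<otimes>\<^bsub>G\<^esub> (if b then \<theta> h else h), b \<noteq> c)),
      one = (\<one>\<^bsub>G\<^esub>, False) \<rparr>"

lemma involution_extension_simps [simp]:
  "x \<in> carrier (involution_extension G \<theta>) \<longleftrightarrow> fst x \<in> carrier G"
  "(g, b) \<otimes>\<^bsub>involution_extension G \<theta>\<^esub> (h, c) = (g \<otimes>\<^bsub>G\<^esub> (if b then \<theta> h else h), b \<noteq> c)"
  "\<one>\<^bsub>involution_extension G \<theta>\<^esub> = (\<one>\<^bsub>G\<^esub>, False)"
  by (auto simp: involution_extension_def mem_Times_iff)

lemma group_involution_extension:
  assumes "group G" "\<theta> \<in> hom G G" "\<And>g. g \<in> carrier G \<Longrightarrow> \<theta> (\<theta> g) = g"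
  shows "group (involution_extension G \<theta>)"
proof -
  interpret group_hom G G \<theta> using assms by (simp add: group_hom_def group_hom_axioms_def)
  show ?thesis
  proof (rule groupI)
    fix x assume "x \<in> carrier (involution_extension G \<theta>)"
    then show "\<exists>y \<in> carrier (involution_extension G \<theta>).
        y \<otimes>\<^bsub>involution_extension G \<theta>\<^esub> x = \<one>\<^bsub>involution_extension G \<theta>\<^esub>"
      by (intro bexI[of _ "(if snd x then \<theta> (inv\<^bsub>G\<^esub> (fst x)) else inv\<^bsub>G\<^esub> (fst x), snd x)"])
        (cases x; auto simp flip: hom_mult)+
  qed (auto simp: assms(3) G.m_assoc)
qed

lemma involution_extension_lift:
  assumes "group H" "\<phi> \<in> hom G H" "\<sigma> \<in> carrier H" "\<sigma> \<otimes>\<^bsub>H\<^esub> \<sigma> = \<one>\<^bsub>H\<^esub>"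
    and "\<And>g. g \<in> carrier G \<Longrightarrow> \<sigma> \<otimes>\<^bsub>H\<^esub> \<phi> g = \<phi> (\<theta> g) \<otimes>\<^bsub>H\<^esub> \<sigma>"
    and "\<theta> \<in> hom G G"
  shows "(\<lambda>(g, b). \<phi> g \<otimes>\<^bsub>H\<^esub> (if b then \<sigma> else \<one>\<^bsub>H\<^esub>)) \<in> hom (involution_extension G \<theta>) H"
proof -
  interpret H: group H by fact
  have c: "\<phi> g \<in> carrier H" "\<theta> g \<in> carrier G" if "g \<in> carrier G" for g
    using hom_in_carrier[OF assms(2) that] hom_in_carrier[OF assms(6) that] by auto
  have s: "\<sigma> \<otimes>\<^bsub>H\<^esub> (\<phi> g \<otimes>\<^bsub>H\<^esub> x) = \<phi> (\<theta> g) \<otimes>\<^bsub>H\<^esub> (\<sigma> \<otimes>\<^bsub>H\<^esub> x)"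
    if "g \<in> carrier G" "x \<in> carrier H" for g x
    using that c assms(3,5) by (simp flip: H.m_assoc)
  show ?thesis
  proof (rule homI)
    fix x y assume "x \<in> carrier (involution_extension G \<theta>)" "y \<in> carrier (involution_extension G \<theta>)"
    then show "(\<lambda>(g, b). \<phi> g \<otimes>\<^bsub>H\<^esub> (if b then \<sigma> else \<one>\<^bsub>H\<^esub>)) (x \<otimes>\<^bsub>involution_extension G \<theta>\<^esub> y) =
      (\<lambda>(g, b). \<phi> g \<otimes>\<^bsub>H\<^esub> (if b then \<sigma> else \<one>\<^bsub>H\<^esub>)) x \<otimes>\<^bsub>H\<^esub>
      (\<lambda>(g, b). \<phi> g \<otimes>\<^bsub>H\<^esub> (if b then \<sigma> else \<one>\<^bsub>H\<^esub>)) y"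
      using assms(3,4) by (cases x; cases y) (auto simp: c s hom_mult[OF assms(2)] H.m_assoc)
  qed (use assms(3) c in auto)
qed


section \<open>The presentation of the alternating group\<close>

lemma B_identification_star_transp:
  assumes "n \<ge> 2" "1 \<le> i" "i < n"
  defines "T \<equiv> star_transp (coxeter_B n) (coxeter_B_gen n)"
  shows "T i \<in> carrier (coxeter_B n)"
    and "B_identification n (T i) = (\<one>\<^bsub>C2_pow n\<^esub>, Transposition.transpose 1 (i + 1))"
proof -
  show "T i \<in> carrier (coxeter_B n)"
    unfolding T_def using assms(3)
    by (intro star_transp_closed[of _ n] group_coxeter_B coxeter_B_gen_closed)
  show "B_identification n (T i) = (\<one>\<^bsub>C2_pow n\<^esub>, Transposition.transpose 1 (i + 1))"
    unfolding T_def
    using hom_star_transp[OF group_coxeter_B group_wreath_C2 B_identification_hom[OF assms(1)],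
        of n "coxeter_B_gen n" "wreath_gen n" i] assms(1-3)
    by (simp add: coxeter_B_gen_closed B_identification_gen star_transp_wreath)
qed

lemma alternating_B_presentation:
  assumes n: "n \<ge> 2"
  shows "\<exists>\<phi> \<in> iso (alt_B_presented n) (alternating_B n). \<forall>i\<in>{1..n - 1}.
    B_identification n (\<phi> (alt_B_gen n i)) = (gamma n 1, Transposition.transpose 1 (i + 1))"
proof -
  define C where "C = coxeter_B n"
  define G where "G = alt_B_presented n"
  define s where "s = coxeter_B_gen n"
  define x where "x = alt_B_gen n"
  define \<beta> where "\<beta> = B_identification n"
  interpret C: group C unfolding C_def by (rule group_coxeter_B)
  interpret Cs: type_B_relations C n s unfolding C_def s_def by (rule coxeter_B_type_B_relations)
  interpret W: group "wreath_C2 n" by (rule group_wreath_C2)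
  interpret B: group_hom C "wreath_C2 n" \<beta>
    using B_identification_hom[OF n]
    by (simp add: group_hom_def group_hom_axioms_def C_def \<beta>_def group_coxeter_B group_wreath_C2)
  have B_inj: "u = v" if "u \<in> carrier C" "v \<in> carrier C" "\<beta> u = \<beta> v" for u v
    using B_identification_iso[OF n] that
    by (auto simp: iso_def bij_betw_def C_def \<beta>_def dest: inj_onD)
  have B_gen: "\<beta> (s i) = wreath_gen n i" if "i < n" for i
    using B_identification_gen[OF n that] by (simp add: \<beta>_def s_def)
  define T where "T = star_transp C s"
  have T: "T i \<in> carrier C" "\<beta> (T i) = (\<one>\<^bsub>C2_pow n\<^esub>, Transposition.transpose 1 (i + 1))"
    if "1 \<le> i" "i < n" for i
    using B_identification_star_transp[OF n that] by (auto simp: T_def C_def s_def \<beta>_def)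
  \<comment> \<open>The generators and their relations are transported from the wreath product back to \<open>C\<close>.\<close>
  define \<beta>' where "\<beta>' = inv_into (carrier C) \<beta>"
  have \<beta>': "\<beta>' \<in> iso (wreath_C2 n) C"
    using C.iso_set_sym[of \<beta> "wreath_C2 n"] B_identification_iso[OF n] by (simp add: \<beta>_def \<beta>'_def C_def)
  define c where "c i = \<beta>' (gamma n 1, Transposition.transpose 1 (i + 1))" for i
  have s0: "s 0 \<in> carrier C" "s 0 \<otimes>\<^bsub>C\<^esub> s 0 = \<one>\<^bsub>C\<^esub>" using n Cs.s_closed Cs.s_square by auto
  have c_eq: "c i = s 0 \<otimes>\<^bsub>C\<^esub> T i" if i: "1 \<le> i" "i < n" for i
  proof -
    have "\<beta> (s 0 \<otimes>\<^bsub>C\<^esub> T i) = (gamma n 1, Transposition.transpose 1 (i + 1))"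
      using n T[OF i] s0 B_gen[of 0]
      by (auto simp: wreath_gen_def wreath_mult sym_group_one perm_act_id gamma_closed)
    moreover have "inj_on \<beta> (carrier C)" using B_inj by (auto intro: inj_onI)
    ultimately show ?thesis
      using T[OF i] s0 inv_into_f_f[of \<beta> "carrier C" "s 0 \<otimes>\<^bsub>C\<^esub> T i"] by (simp add: c_def \<beta>'_def)
  qed
  have c: "c i \<in> carrier C" "\<beta> (c i) = (gamma n 1, Transposition.transpose 1 (i + 1))"
    if "1 \<le> i" "i < n" for i
    using that n T[OF that] s0 B_gen[of 0]
    by (auto simp: c_eq wreath_gen_def wreath_mult sym_group_one perm_act_id gamma_closed)
  have TT: "T i \<otimes>\<^bsub>C\<^esub> T i = \<one>\<^bsub>C\<^esub>" if i: "1 \<le> i" "i < n" for i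
  proof (rule B_inj)
    have "Transposition.transpose 1 (i + 1) permutes {1..n}"
      using i by (intro permutes_swap_id) auto
    then show "\<beta> (T i \<otimes>\<^bsub>C\<^esub> T i) = \<beta> \<one>\<^bsub>C\<^esub>"
      using T[OF i] by (simp add: wreath_mult wreath_one perm_act_one)
  qed (use T[OF i] in auto)
  have TTT: "T i \<otimes>\<^bsub>C\<^esub> (T (i + 1) \<otimes>\<^bsub>C\<^esub> T i) = s (i + 1)" if i: "1 \<le> i" "i + 1 < n" for i
  proof (rule B_inj)
    have "Transposition.transpose 1 (i + 1) permutes {1..n}"
      "Transposition.transpose 1 (i + 2) permutes {1..n}"
      using i by (auto intro!: permutes_swap_id)
    moreover have "Transposition.transpose 1 (i + 1) \<circ> (Transposition.transpose 1 (i + 2) \<circ>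
        Transposition.transpose 1 (i + 1)) = Transposition.transpose (i + 1) (i + 2)"
      using i by (auto simp: fun_eq_iff Transposition.transpose_def)
    ultimately show "\<beta> (T i \<otimes>\<^bsub>C\<^esub> (T (i + 1) \<otimes>\<^bsub>C\<^esub> T i)) = \<beta> (s (i + 1))"
      using T[of i] T[of "i + 1"] i B_gen[of "i + 1"]
      by (simp add: wreath_mult wreath_gen_def perm_act_one)
  qed (use T[of i] T[of "i + 1"] i Cs.s_closed in auto)
  interpret Cc: alt_B_relations C n c
    unfolding c_def[abs_def] using \<beta>'
    by (intro alt_B_relations.hom_relations[OF wreath_alt_B_relations] C.is_group) (simp add: iso_def)
  define \<phi> where "\<phi> = pres_lift C c"
  have \<phi>: "\<phi> \<in> hom G C" "\<And>i. 1 \<le> i \<Longrightarrow> i < n \<Longrightarrow> \<phi> (x i) = c i"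
    using Cc.alt_B_lift by (auto simp: \<phi>_def G_def x_def)
  interpret Gx: alt_B_relations G n x
    unfolding G_def x_def by (rule alt_B_presented_relations)
  \<comment> \<open>\<open>\<theta>\<close> is what conjugation by \<open>s 0\<close> has to become on \<open>G\<close>.\<close>
  define \<theta> where "\<theta> = pres_lift G (\<lambda>i. inv\<^bsub>G\<^esub> (x i))"
  have \<theta>: "\<theta> \<in> hom G G" "\<And>i. 1 \<le> i \<Longrightarrow> i < n \<Longrightarrow> \<theta> (x i) = inv\<^bsub>G\<^esub> (x i)"
    using alt_B_relations.alt_B_lift[OF Gx.inverse_relations] by (auto simp: \<theta>_def G_def x_def)
  interpret \<phi>: group_hom G C \<phi>
    using \<phi>(1) by (simp add: group_hom_def group_hom_axioms_def Gx.is_group C.is_group)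
  interpret \<theta>: group_hom G G \<theta>
    using \<theta>(1) by (simp add: group_hom_def group_hom_axioms_def Gx.is_group)
  have hom_eq: "h g = h' g" if "group H" "h \<in> hom G H" "h' \<in> hom G H"
      "\<And>i. 1 \<le> i \<Longrightarrow> i < n \<Longrightarrow> h (x i) = h' (x i)" "g \<in> carrier G" for h h' g and H :: "('z, 'y) monoid_scheme"
    using alt_B_presented_hom_eq[of H h n h' g] that by (auto simp: G_def x_def)
  have \<theta>\<theta>: "\<theta> (\<theta> g) = g" if "g \<in> carrier G" for g
  proof (rule hom_eq[OF Gx.is_group _ _ _ that, of "\<lambda>g. \<theta> (\<theta> g)" "\<lambda>g. g"])
    show "(\<lambda>g. \<theta> (\<theta> g)) \<in> hom G G" using hom_compose[OF \<theta>(1) \<theta>(1)] by (simp add: o_def)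
    show "(\<lambda>g. g) \<in> hom G G" by (simp add: hom_def)
  qed (simp add: \<theta>(2) Gx.a_closed)
  define K where "K = involution_extension G \<theta>"
  interpret K: group K
    unfolding K_def by (rule group_involution_extension[OF Gx.is_group \<theta>(1) \<theta>\<theta>])
  \<comment> \<open>In \<open>K\<close> the adjoined involution \<open>e\<close> plays the role of \<open>s 0\<close>, and \<open>e \<otimes> a\<^sub>i\<close> that of \<open>(1, i + 1)\<close>.\<close>
  define e where "e = (\<one>\<^bsub>G\<^esub>, True)"
  have emb: "(\<lambda>g. (g, False)) \<in> hom G K" by (auto simp: hom_def K_def)
  interpret Ka: alt_B_relations K n "\<lambda>i. (x i, False)"
    by (rule Gx.hom_relations[OF K.is_group emb])
  interpret Kt: star_relations K n e "\<lambda>i. e \<otimes>\<^bsub>K\<^esub> (x i, False)"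
    by (rule Ka.star_relations_extension) (auto simp: e_def K_def \<theta>(2) Gx.a_closed)
  interpret KS: type_B_relations K n Kt.coxeter_gen by (rule Kt.coxeter_gen_type_B)
  define \<psi> where "\<psi> = pres_lift K Kt.coxeter_gen"
  have \<psi>: "\<psi> \<in> hom C K" "\<And>i. i < n \<Longrightarrow> \<psi> (s i) = Kt.coxeter_gen i"
    using KS.coxeter_B_lift[OF n] by (auto simp: \<psi>_def C_def s_def)
  interpret \<psi>: group_hom C K \<psi>
    using \<psi>(1) by (simp add: group_hom_def group_hom_axioms_def K.is_group C.is_group)
  have \<psi>\<phi>: "\<psi> (\<phi> g) = (g, False)" if "g \<in> carrier G" for g
  proof (rule hom_eq[OF K.is_group _ emb _ that, of "\<lambda>g. \<psi> (\<phi> g)"])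
    show "(\<lambda>g. \<psi> (\<phi> g)) \<in> hom G K" using hom_compose[OF \<phi>(1) \<psi>(1)] by (simp add: o_def)
    fix i assume i: "1 \<le> i" "i < n"
    have "\<psi> (T i) = e \<otimes>\<^bsub>K\<^esub> (x i, False)"
      using hom_star_transp[OF C.is_group K.is_group \<psi>(1), of n s Kt.coxeter_gen i]
        Kt.star_transp_coxeter_gen[OF i] i Cs.s_closed \<psi>(2) by (simp add: T_def)
    moreover have "\<psi> (s 0) = e" using \<psi>(2)[of 0] n by (simp add: Kt.coxeter_gen_def)
    ultimately show "\<psi> (\<phi> (x i)) = (x i, False)"
      using \<phi>(2)[OF i] T[OF i] s0 Ka.a_closed[OF i] Kt.theta_closed Kt.theta_square
      by (simp add: c_eq[OF i] K.square_cancel)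
  qed
  have s0_conj: "s 0 \<otimes>\<^bsub>C\<^esub> \<phi> g = \<phi> (\<theta> g) \<otimes>\<^bsub>C\<^esub> s 0" if "g \<in> carrier G" for g
  proof -
    have "s 0 \<otimes>\<^bsub>C\<^esub> \<phi> g \<otimes>\<^bsub>C\<^esub> s 0 = \<phi> (\<theta> g)"
    proof (rule hom_eq[OF C.is_group _ _ _ that, of "\<lambda>g. s 0 \<otimes>\<^bsub>C\<^esub> \<phi> g \<otimes>\<^bsub>C\<^esub> s 0" "\<lambda>g. \<phi> (\<theta> g)"])
      show "(\<lambda>g. s 0 \<otimes>\<^bsub>C\<^esub> \<phi> g \<otimes>\<^bsub>C\<^esub> s 0) \<in> hom G C"
        using s0 by (auto simp: hom_def C.m_assoc C.square_cancel)
      show "(\<lambda>g. \<phi> (\<theta> g)) \<in> hom G C" using hom_compose[OF \<theta>(1) \<phi>(1)] by (simp add: o_def)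
      fix i assume i: "1 \<le> i" "i < n"
      have "(s 0 \<otimes>\<^bsub>C\<^esub> c i \<otimes>\<^bsub>C\<^esub> s 0) \<otimes>\<^bsub>C\<^esub> c i = \<one>\<^bsub>C\<^esub>"
        using s0 T[OF i] TT[OF i] by (simp add: c_eq[OF i] C.m_assoc C.square_cancel)
      then have "inv\<^bsub>C\<^esub> (c i) = s 0 \<otimes>\<^bsub>C\<^esub> c i \<otimes>\<^bsub>C\<^esub> s 0"
        using c[OF i] s0 by (intro C.inv_equality) auto
      then show "s 0 \<otimes>\<^bsub>C\<^esub> \<phi> (x i) \<otimes>\<^bsub>C\<^esub> s 0 = \<phi> (\<theta> (x i))"
        using \<phi>(2) \<theta>(2) i Gx.a_closed by simp
    qed
    then have "s 0 \<otimes>\<^bsub>C\<^esub> \<phi> g \<otimes>\<^bsub>C\<^esub> s 0 \<otimes>\<^bsub>C\<^esub> s 0 = \<phi> (\<theta> g) \<otimes>\<^bsub>C\<^esub> s 0" by simp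
    then show ?thesis using that s0 by (simp add: C.m_assoc)
  qed
  \<comment> \<open>The candidate for the inverse of \<open>\<psi>\<close>.\<close>
  define \<chi> where "\<chi> = (\<lambda>(g, b). \<phi> g \<otimes>\<^bsub>C\<^esub> (if b then s 0 else \<one>\<^bsub>C\<^esub>))"
  have \<chi>: "\<chi> \<in> hom K C"
    unfolding \<chi>_def K_def
    by (rule involution_extension_lift[OF C.is_group \<phi>(1) s0 s0_conj \<theta>(1)])
  interpret \<chi>: group_hom K C \<chi>
    using \<chi> by (simp add: group_hom_def group_hom_axioms_def K.is_group C.is_group)
  have \<chi>e: "\<chi> e = s 0" using s0 by (simp add: \<chi>_def e_def)
  have \<chi>t: "\<chi> (e \<otimes>\<^bsub>K\<^esub> (x i, False)) = T i" if i: "1 \<le> i" "i < n" for i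
  proof -
    have "\<chi> (x i, False) = c i" using \<phi>(2)[OF i] c[OF i] by (simp add: \<chi>_def)
    then show ?thesis
      using \<chi>e s0 T[OF i] Ka.a_closed[OF i] Kt.theta_closed by (simp add: c_eq[OF i] C.square_cancel)
  qed
  have \<chi>\<psi>: "\<chi> (\<psi> u) = u" if "u \<in> carrier C" for u
    unfolding C_def
  proof (rule coxeter_B_hom_eq[of C "\<lambda>u. \<chi> (\<psi> u)" n "\<lambda>u. u"])
    show "(\<lambda>u. \<chi> (\<psi> u)) \<in> hom (coxeter_B n) C"
      using hom_compose[OF \<psi>(1) \<chi>] by (simp add: o_def C_def)
    show "(\<lambda>u. u) \<in> hom (coxeter_B n) C" by (simp add: hom_def C_def)
    fix i assume i: "i < n"
    consider "i = 0" | "i = 1" | j where "i = j + 1" "1 \<le> j"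
      by (cases i) (auto, metis One_nat_def Suc_leI not_gr_zero)
    then have "\<chi> (Kt.coxeter_gen i) = s i"
    proof cases
      case 1
      then show ?thesis using \<chi>e by (simp add: Kt.coxeter_gen_def)
    next
      case 2
      then show ?thesis using \<chi>t[of 1] i by (simp add: Kt.coxeter_gen_def T_def)
    next
      case (3 j)
      then have j: "1 \<le> j" "j < n" "1 \<le> j + 1" "j + 1 < n" using i by auto
      have "Kt.coxeter_gen i = (e \<otimes>\<^bsub>K\<^esub> (x j, False)) \<otimes>\<^bsub>K\<^esub>
          ((e \<otimes>\<^bsub>K\<^esub> (x (j + 1), False)) \<otimes>\<^bsub>K\<^esub> (e \<otimes>\<^bsub>K\<^esub> (x j, False)))"
        using 3 by (simp add: Kt.coxeter_gen_def)
      then have "\<chi> (Kt.coxeter_gen i) = T j \<otimes>\<^bsub>C\<^esub> (T (j + 1) \<otimes>\<^bsub>C\<^esub> T j)"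
        using \<chi>t[OF j(1,2)] \<chi>t[OF j(3,4)] Kt.t_closed[OF j(1,2)] Kt.t_closed[OF j(3,4)]
        by (simp only: \<chi>.hom_mult K.m_closed)
      then show ?thesis using TTT[OF j(1,4)] 3 by simp
    qed
    then show "\<chi> (\<psi> (coxeter_B_gen n i)) = coxeter_B_gen n i" using \<psi>(2)[OF i] by (simp add: s_def)
  qed (use that C.is_group in \<open>auto simp: C_def\<close>)
  define sgn where "sgn = coxeter_B_sign n"
  have sgn: "sgn \<in> hom C sign_img" unfolding sgn_def C_def by (rule coxeter_B_sign_hom)
  interpret sgn: group_hom C sign_img sgn
    using sgn by (simp add: group_hom_def group_hom_axioms_def sign_img_is_group C.is_group)
  have sgn\<phi>: "sgn (\<phi> g) = 1" if "g \<in> carrier G" for g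
  proof (rule hom_eq[OF sign_img_is_group _ _ _ that, of "\<lambda>g. sgn (\<phi> g)" "\<lambda>g. 1"])
    show "(\<lambda>g. sgn (\<phi> g)) \<in> hom G sign_img" using hom_compose[OF \<phi>(1) sgn] by (simp add: o_def)
    show "(\<lambda>g. 1) \<in> hom G sign_img" by (simp add: hom_def sign_img_def)
    fix i assume i: "1 \<le> i" "i < n"
    have "sgn (c i) = wreath_sign n (\<beta> (c i))"
      using coxeter_B_sign_eq[OF n] c[OF i] by (simp add: sgn_def \<beta>_def C_def)
    then show "sgn (\<phi> (x i)) = 1"
      using i c(2)[OF i] \<phi>(2)[OF i] by (simp add: wreath_sign_def C2_pow_sign_gamma sign_swap_id)
  qed
  have carrier: "carrier (alternating_B n) = {u \<in> carrier C. sgn u = 1}"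
    by (simp add: alternating_B_carrier C_def sgn_def)
  have "\<phi> ` carrier G = carrier (alternating_B n)"
  proof
    show "\<phi> ` carrier G \<subseteq> carrier (alternating_B n)" using sgn\<phi> by (auto simp: carrier)
    show "carrier (alternating_B n) \<subseteq> \<phi> ` carrier G"
    proof
      fix u assume "u \<in> carrier (alternating_B n)"
      then have u: "u \<in> carrier C" "sgn u = 1" by (auto simp: carrier)
      obtain g b where gb: "\<psi> u = (g, b)" by (cases "\<psi> u")
      have g: "g \<in> carrier G" using \<psi>.hom_closed[OF u(1)] gb by (simp add: K_def)
      have ug: "u = \<phi> g \<otimes>\<^bsub>C\<^esub> (if b then s 0 else \<one>\<^bsub>C\<^esub>)"
        using \<chi>\<psi>[OF u(1)] gb by (simp add: \<chi>_def)
      have "\<not> b"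
      proof
        assume b
        then have "sgn u = sgn (\<phi> g) \<otimes>\<^bsub>sign_img\<^esub> sgn (s 0)" using ug g s0 by simp
        moreover have "sgn (s 0) = -1" using coxeter_B_sign_gen[of 0 n] n by (simp add: sgn_def s_def)
        ultimately show False using u(2) sgn\<phi>[OF g] by (simp add: sign_img_def)
      qed
      then show "u \<in> \<phi> ` carrier G" using ug g by simp
    qed
  qed
  moreover have "inj_on \<phi> (carrier G)"
    using \<psi>\<phi> by (metis inj_onI prod.inject)
  moreover have "\<phi> \<in> hom G (alternating_B n)"
  proof -
    have "mult (alternating_B n) = mult C" by (simp add: alternating_B_def C_def)
    then show ?thesis using \<phi>(1) sgn\<phi> by (auto simp: hom_def carrier)
  qed
  ultimately have "\<phi> \<in> iso G (alternating_B n)" by (simp add: iso_def bij_betw_def)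
  moreover have "\<beta> (\<phi> (x i)) = (gamma n 1, Transposition.transpose 1 (i + 1))" if "i \<in> {1..n - 1}" for i
    using that n \<phi>(2)[of i] c(2)[of i] by auto
  ultimately show ?thesis unfolding G_def x_def \<beta>_def by blast
qed

theorem mainTheorem6:
  fixes n :: nat
  assumes "n \<ge> 2"
  shows "B_identification n \<in> iso (coxeter_B n) (wreath_C2 n)
    \<and> (\<forall>i<n. B_identification n (coxeter_B_gen n i) = wreath_gen n i)
    \<and> B_identification n ` carrier (alternating_B n) = alternating_wreath n
    \<and> (\<exists>\<phi> \<in> iso (alt_B_presented n) (alternating_B n).
         \<forall>i\<in>{1..n - 1}. B_identification n (\<phi> (alt_B_gen n i))
           = (gamma n 1, Transposition.transpose 1 (i + 1)))"
  using B_identification_iso[OF assms] B_identification_gen[OF assms]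
    B_identification_alternating[OF assms] alternating_B_presentation[OF assms]
  by blast

end
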